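(* Let $p\ge 2$, $-\infty\le a<b\le+\infty$, let $h:(0,\infty)\to(0,\infty)$ be a continuous function, let $H:(0,\infty)\to\mathbb{R}$ be a locally absolutely continuous primitive of $h$ and $\mathcal{T}_h:=H/h:(0,\infty)\to\mathbb{R}$. Let $\tilde H$ be the extension (not necessarily continuous) of $H$ to $[0,\infty)$ with $\tilde H(0)=0$. Assume further that each of the two functions $h$ and $|\mathcal{T}_h|^{\frac p2}h$ is either bounded or nonincreasing in some neighborhood of $0$. Let $\tilde{\mathcal{R}}_{\ge 0}(a,b)$ be the set of all $f\in W^{2,1}_{loc}((a,b))$ such that $f\ge 0$ a.e. and $$\liminf_{R\nearrow b}|f'(R)|^{p-2}f'(R)\tilde H(f(R))-\limsup_{r\searrow a}|f'(r)|^{p-2}f'(r)\tilde H(f(r))\le 0 .$$ Then for every nonnegative function $f\in\tilde{\mathcal{R}}_{\ge 0}(a,b)$, $$\int_{(a,b)\cap\{x:f(x)>0\}}|f'(x)|^p h(f(x))\,dx\le\left(\sqrt{p-1}\right)^p\int_{(a,b)\cap\{x:f(x)>0\}}\left|f''(x)\,\mathcal{T}_h(f(x))\right|^{\frac p2}h(f(x))\,dx .$$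
   Context: "In some neighborhood of $0$" means on some interval $(0,\epsilon]$, $\epsilon>0$. Here $f\in W^{2,1}_{loc}$ is identified with its $C^1$ representative whose derivative $f'$ is locally absolutely continuous; $f''$ is the a.e. defined second derivative. Functions are real valued, and integrals of nonnegative functions are taken in $[0,+\infty]$. *)

theory Defs
  imports "HOL-Analysis.Analysis"
begin

definition abs_continuous_on :: "real set \<Rightarrow> (real \<Rightarrow> real) \<Rightarrow> bool" where
  "abs_continuous_on S g \<longleftrightarrow>
     (\<forall>\<epsilon>>0. \<exists>\<delta>>0. \<forall>D. D division_of \<Union>D \<and> \<Union>D \<subseteq> S \<and> (\<Sum>K\<in>D. measure lborel K) < \<delta> \<longrightarrow>
        (\<Sum>K\<in>D. \<bar>g (Sup K) - g (Inf K)\<bar>) < \<epsilon>)"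

definition loc_abs_continuous_on :: "real set \<Rightarrow> (real \<Rightarrow> real) \<Rightarrow> bool" where
  "loc_abs_continuous_on S g \<longleftrightarrow> (\<forall>c d. {c..d} \<subseteq> S \<longrightarrow> abs_continuous_on {c..d} g)"

definition loc_AC_primitive :: "(real \<Rightarrow> real) \<Rightarrow> (real \<Rightarrow> real) \<Rightarrow> bool" where
  "loc_AC_primitive H h \<longleftrightarrow> loc_abs_continuous_on {0<..} H \<and>
     (AE s in lebesgue. 0 < s \<longrightarrow> (H has_real_derivative h s) (at s))"

definition T_transform :: "(real \<Rightarrow> real) \<Rightarrow> (real \<Rightarrow> real) \<Rightarrow> real \<Rightarrow> real" where
  "T_transform H h s = H s / h s"

definition zero_extension :: "(real \<Rightarrow> real) \<Rightarrow> real \<Rightarrow> real" where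
  "zero_extension H s = (if s = 0 then 0 else H s)"

definition bounded_or_nonincreasing_near_0 :: "(real \<Rightarrow> real) \<Rightarrow> bool" where
  "bounded_or_nonincreasing_near_0 g \<longleftrightarrow>
     (\<exists>\<epsilon>>0. bounded (g ` {0<..\<epsilon>}) \<or> antimono_on {0<..\<epsilon>} g)"

text \<open>Elements of the Sobolev space are represented by their \<open>C\<^sup>1\<close> representatives. Continuity of
  \<open>deriv f\<close> follows from its local absolute continuity; the second derivative, defined almost
  everywhere, is \<open>deriv (deriv f)\<close>. Values outside \<open>(a,b)\<close> are irrelevant.\<close>

definition W21_loc :: "ereal \<Rightarrow> ereal \<Rightarrow> (real \<Rightarrow> real) set" where
  "W21_loc a b = {f. (\<forall>x \<in> einterval a b. f differentiable at x) \<and>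
                     loc_abs_continuous_on (einterval a b) (deriv f)}"

definition boundary_term :: "real \<Rightarrow> (real \<Rightarrow> real) \<Rightarrow> (real \<Rightarrow> real) \<Rightarrow> real \<Rightarrow> real" where
  "boundary_term p H f x = \<bar>deriv f x\<bar> powr (p - 2) * deriv f x * zero_extension H (f x)"

text \<open>The one-sided limits are taken along the filters \<open>at_left b\<close>, \<open>at_right a\<close> of the extended reals,
  which covers infinite end points. The difference is taken in the extended reals, where both
  \<open>\<infinity> - \<infinity>\<close> and \<open>-\<infinity> - (-\<infinity>)\<close> equal \<open>\<infinity>\<close>: the condition fails if the difference is undefined.\<close>

definition R_nonneg :: "real \<Rightarrow> (real \<Rightarrow> real) \<Rightarrow> ereal \<Rightarrow> ereal \<Rightarrow> (real \<Rightarrow> real) set" where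
  "R_nonneg p H a b = {f \<in> W21_loc a b.
     (AE x in lebesgue. x \<in> einterval a b \<longrightarrow> 0 \<le> f x) \<and>
     Liminf (at_left b) (\<lambda>R. ereal (boundary_term p H f (real_of_ereal R)))
       - Limsup (at_right a) (\<lambda>r. ereal (boundary_term p H f (real_of_ereal r))) \<le> 0}"

end

theory Submission
  imports Defs
begin

text \<open>The quantity \<open>G = |f'|^(p-2) f' H(f)\<close>, extended by \<open>0\<close> to the zeros of \<open>f\<close>, is locally absolutely
  continuous on \<open>{f > 0}\<close>, and there \<open>G' = |f'|^p h(f) + (p-1) |f'|^(p-2) f'' H(f)\<close>.
  Young's inequality with exponents \<open>p/(p-2)\<close> and \<open>p/2\<close> bounds the last term from below by
  \<open>- (1 - 2/p) |f'|^p h(f) - (2/p) K |f'' T(f)|^(p/2) h(f)\<close> with \<open>K = (p-1)^(p/2)\<close>, so that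
  \<open>G' \<ge> (2/p) (|f'|^p h(f) - K |f'' T(f)|^(p/2) h(f))\<close> almost everywhere on \<open>{f > 0}\<close>.
  Integrating over \<open>[r,R]\<close> and letting \<open>r\<close> and \<open>R\<close> tend to the end points along sequences on which the
  boundary condition controls \<open>G\<close> gives the claim with the constant \<open>K = (sqrt (p-1))^p\<close>; as the
  inequality is already linear in the two integrals, no a priori finiteness of the left-hand side is needed.

  Two points need work. The first is that \<open>f\<close> may have interior zeros, where \<open>H(f)\<close> may blow up. At such a
  zero \<open>f' = 0\<close>, so if \<open>G\<close> stays away from \<open>0\<close> with the wrong sign on one side of the zero, where \<open>f > 0\<close>,
  then \<open>H(f)\<close> tends to \<open>-\<infinity>\<close> and \<open>f\<close> is strictly monotone there. A pointwise Hardy estimate (\<open>hardy_segment\<close>) then shows that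
  \<open>|f'|^(p-1) |H(f)|\<close> is small, as the right-hand integrand is integrable: a contradiction. Hence \<open>G\<close> may be
  continued across zeros (\<open>boundary_term_small_near_zero\<close>), and the pieces are glued by bisection
  (\<open>cut_energy_increment\<close>), without decomposing \<open>{f > 0}\<close> into components.

  The second is the fundamental theorem of calculus for absolutely continuous functions
  (\<open>abs_continuous_FTC\<close>). It rests on the Vitali covering theorem, in the form that the increment of an
  absolutely continuous function is controlled by its slopes over arbitrarily short intervals around almost
  every point. Forward difference quotients have an integrable limit point \<open>g\<close> almost everywhere, and the
  slope criterion, applied to \<open>F - \<integral>g\<close> and its negative, shows that \<open>F\<close> is an indefinite integral of \<open>g\<close>.\<close>

section \<open>Divisions and the Vitali covering theorem\<close>

(* As destruction rules these facts make the classical reasoner diverge on goals about divisions. *)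
declare division_ofD [rule del]

lemma division_sum_telescope:
  fixes F :: "real \<Rightarrow> real"
  assumes "c \<le> d" and "D division_of {c..d}"
  shows "(\<Sum>K\<in>D. F (Sup K) - F (Inf K)) = F d - F c"
proof -
  let ?f = "(\<lambda>K::real set. if K = {} then 0 else F (interval_upperbound K) - F (interval_lowerbound K))"
  interpret operative_real plus 0 ?f
    rewrites "comm_monoid_set.F (+) 0 = sum"
    by standard[1] (auto simp add: sum_def)
  from assms(2) have "sum ?f D = ?f {c..d}"
    by (rule division)
  moreover have "sum ?f D = (\<Sum>K\<in>D. F (Sup K) - F (Inf K))"
  proof (rule sum.cong)
    fix K assume K: "K \<in> D"
    obtain x y where "K = cbox x y" "K \<noteq> {}"
      using division_ofD(3)[OF assms(2) K] division_ofD(4)[OF assms(2) K] by auto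
    then show "?f K = F (Sup K) - F (Inf K)"
      by auto
  qed simp
  ultimately show ?thesis
    using assms(1) by simp
qed

text \<open>If almost every point lies in arbitrarily short intervals with property \<open>Q\<close>, then some division of
  \<open>[c,d]\<close> consists of intervals with property \<open>Q\<close> up to cells of small total length. This is the
  Vitali covering theorem, cut down to finitely many intervals and completed to a division.\<close>

lemma vitali_division:
  fixes c d :: real
  assumes cd: "c < d" and N: "negligible N" and eta: "0 < \<eta>"
    and fine: "\<And>x \<delta>. c < x \<Longrightarrow> x < d \<Longrightarrow> x \<notin> N \<Longrightarrow> 0 < \<delta> \<Longrightarrow>
        \<exists>y z. c \<le> y \<and> z \<le> d \<and> y < z \<and> y \<le> x \<and> x \<le> z \<and> z - y < \<delta> \<and> Q y z"
  shows "\<exists>P D. P \<subseteq> D \<and> D division_of {c..d} \<and> (\<forall>K\<in>P. \<exists>y z. y < z \<and> K = {y..z} \<and> Q y z) \<and>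
    (\<Sum>K\<in>D - P. measure lborel K) < \<eta>"
proof -
  define J where "J = {(y, z). c \<le> y \<and> z \<le> d \<and> y < z \<and> Q y z}"
  define m r where "m = (\<lambda>i::real\<times>real. (fst i + snd i) / 2)" and "r = (\<lambda>i::real\<times>real. (snd i - fst i) / 2)"
  have ball_eq: "cball (m i) (r i) = {fst i..snd i}" for i
    by (auto simp: m_def r_def cball_eq_atLeastAtMost field_simps)
  obtain C where C: "countable C" "C \<subseteq> J"
      "pairwise (\<lambda>i j. disjnt (cball (m i) (r i)) (cball (m j) (r j))) C"
      "negligible (({c<..<d} - N) - (\<Union>i\<in>C. cball (m i) (r i)))"
  proof (rule Vitali_covering_theorem_cballs[of J r "{c<..<d} - N" m])
    show "0 < r i" if "i \<in> J" for i
      using that by (auto simp: J_def r_def)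
    show "\<exists>i. i \<in> J \<and> x \<in> cball (m i) (r i) \<and> r i < \<delta>" if x: "x \<in> {c<..<d} - N" "0 < \<delta>" for x \<delta>
    proof -
      have "c < x" "x < d" "x \<notin> N" using x(1) by auto
      from fine[OF this x(2)] obtain y z
        where "c \<le> y \<and> z \<le> d \<and> y < z \<and> y \<le> x \<and> x \<le> z \<and> z - y < \<delta> \<and> Q y z"
        by (elim exE)
      then show ?thesis
        unfolding ball_eq by (intro exI[of _ "(y, z)"]) (auto simp: J_def r_def)
    qed
  qed (rule that)
  define \<C> where "\<C> = (\<lambda>i. {fst i..snd i}) ` C"
  have sub: "\<Union>\<C> \<subseteq> {c..d}"
    using C(2) by (fastforce simp: \<C>_def J_def less_eq_real_def)
  have meas: "measure lebesgue (\<Union>\<C>) = d - c"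
  proof -
    have "negligible ({c..d} - \<Union>\<C>)"
    proof (rule negligible_subset)
      show "negligible (({c<..<d} - N - (\<Union>i\<in>C. cball (m i) (r i))) \<union> N \<union> {c,d})"
        using C(4) N by (intro negligible_Un) simp_all
    qed (auto simp: ball_eq \<C>_def)
    moreover have "negligible (\<Union>\<C> - {c..d})"
      using sub by (simp add: Diff_eq_empty_iff[THEN iffD2])
    ultimately have "negligible (({c..d} - \<Union>\<C>) \<union> (\<Union>\<C> - {c..d}))"
      by (rule negligible_Un)
    from measure_negligible_symdiff[OF _ this] show ?thesis
      using cd by auto
  qed
  obtain P where P: "P \<subseteq> \<C>" "finite P" "measure lebesgue (\<Union>\<C>) - \<eta> < measure lebesgue (\<Union>P)"
  proof (rule measure_countable_Union_approachable[of \<C> \<eta> "d - c"])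
    show "countable \<C>" using C(1) by (simp add: \<C>_def)
    show "X \<in> lmeasurable" if "X \<in> \<C>" for X using that by (auto simp: \<C>_def)
    show "measure lebesgue (\<Union>D') \<le> d - c" if "D' \<subseteq> \<C>" "finite D'" for D'
    proof -
      have "measure lebesgue (\<Union>D') \<le> measure lebesgue {c..d}"
      proof (rule measure_mono_fmeasurable)
        show "\<Union>D' \<subseteq> {c..d}" using that(1) sub by blast
        show "\<Union>D' \<in> sets lebesgue"
          using that by (intro sets.finite_Union) (auto simp: \<C>_def)
      qed simp
      then show ?thesis using cd by simp
    qed
  qed (rule eta, rule that)
  have Pint: "\<exists>y z. y < z \<and> K = {y..z} \<and> Q y z" if "K \<in> P" for K
  proof -
    obtain i where "i \<in> C" "K = {fst i..snd i}"
      using \<open>K \<in> P\<close> P(1) unfolding \<C>_def by blast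
    then show ?thesis
      using C(2) by (intro exI[of _ "fst i"] exI[of _ "snd i"]) (auto simp: J_def)
  qed
  have Pdis: "K1 \<inter> K2 = {}" if "K1 \<in> P" "K2 \<in> P" "K1 \<noteq> K2" for K1 K2
  proof -
    obtain i j where ij: "i \<in> C" "j \<in> C" "K1 = {fst i..snd i}" "K2 = {fst j..snd j}"
      using \<open>K1 \<in> P\<close> \<open>K2 \<in> P\<close> P(1) unfolding \<C>_def by blast
    with \<open>K1 \<noteq> K2\<close> have "i \<noteq> j" by auto
    with C(3) ij show ?thesis
      unfolding pairwise_def disjnt_def ball_eq by blast
  qed
  have Pdiv: "P division_of \<Union>P"
  proof (rule division_ofI)
    show "interior K1 \<inter> interior K2 = {}" if "K1 \<in> P" "K2 \<in> P" "K1 \<noteq> K2" for K1 K2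
      using Pdis[OF that] interior_subset by blast
    show "K \<noteq> {}" if "K \<in> P" for K using Pint[OF that] by auto
    show "\<exists>a b. K = cbox a b" if "K \<in> P" for K using Pint[OF that] by (metis box_real(2))
  qed (use P(2) in auto)
  have "\<Union>P \<subseteq> cbox c d" using P(1) sub by auto
  then obtain D where D: "P \<subseteq> D" "D division_of cbox c d"
    using partial_division_extend_interval[OF Pdiv] by blast
  have "measure lebesgue (\<Union>P) = (\<Sum>K\<in>P. measure lebesgue K)"
  proof (rule measure_Union'[OF P(2)])
    show "pairwise disjnt P" using Pdis by (simp add: pairwise_def disjnt_def)
    show "K \<in> lmeasurable" if "K \<in> P" for K using Pint[OF that] by auto
  qed
  also have "\<dots> = (\<Sum>K\<in>P. measure lborel K)"
  proof (rule sum.cong)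
    fix K assume "K \<in> P"
    then obtain y z where "K = {y..z}" using Pint by blast
    then show "measure lebesgue K = measure lborel K" by simp
  qed simp
  finally have 1: "(\<Sum>K\<in>P. measure lborel K) > d - c - \<eta>"
    using P(3) meas by simp
  have "(\<Sum>K\<in>D. measure lborel K) = d - c"
    using additive_content_division[OF D(2)] cd by simp
  moreover have "(\<Sum>K\<in>D. measure lborel K) = (\<Sum>K\<in>D - P. measure lborel K) + (\<Sum>K\<in>P. measure lborel K)"
    using D by (intro sum.subset_diff division_of_finite)
  ultimately have "(\<Sum>K\<in>D - P. measure lborel K) < \<eta>" using 1 by simp
  moreover have "D division_of {c..d}" using D(2) by simp
  moreover have "\<forall>K\<in>P. \<exists>y z. y < z \<and> K = {y..z} \<and> Q y z"
    by (intro ballI Pint)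
  ultimately show ?thesis
    by (intro exI[of _ P] exI[of _ D] conjI D(1))
qed

section \<open>Absolutely continuous functions and their slopes\<close>

lemma abs_continuous_onD:
  assumes "abs_continuous_on S F" and "0 < \<epsilon>"
  shows "\<exists>\<delta>>0. \<forall>D. D division_of \<Union>D \<longrightarrow> \<Union>D \<subseteq> S \<longrightarrow> (\<Sum>K\<in>D. measure lborel K) < \<delta> \<longrightarrow>
        (\<Sum>K\<in>D. \<bar>F (Sup K) - F (Inf K)\<bar>) < \<epsilon>"
  using assms(1)[unfolded abs_continuous_on_def, rule_format, OF assms(2)] by meson

lemma abs_continuous_on_subset:
  "abs_continuous_on S F \<Longrightarrow> T \<subseteq> S \<Longrightarrow> abs_continuous_on T F"
  unfolding abs_continuous_on_def by (meson subset_trans)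

text \<open>Closure properties of absolute continuity are all derived from this comparison of increments.\<close>

lemma abs_continuous_on_dominated:
  fixes F1 F2 G :: "real \<Rightarrow> real"
  assumes F1: "abs_continuous_on S F1" and F2: "abs_continuous_on S F2"
    and dom: "\<And>y z. y \<in> S \<Longrightarrow> z \<in> S \<Longrightarrow> y \<le> z \<Longrightarrow> \<bar>G z - G y\<bar> \<le> C * \<bar>F1 z - F1 y\<bar> + C * \<bar>F2 z - F2 y\<bar>"
  shows "abs_continuous_on S G"
  unfolding abs_continuous_on_def
proof (intro allI impI)
  fix \<epsilon> :: real assume "0 < \<epsilon>"
  define m where "m = \<bar>C\<bar> + 1"
  define e where "e = \<epsilon> / (2 * m)"
  have m: "0 < m" "C \<le> m" by (simp_all add: m_def)
  then have e: "0 < e" using \<open>0 < \<epsilon>\<close> by (simp add: e_def)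
  obtain \<delta>1 where \<delta>1: "0 < \<delta>1" "\<And>D. D division_of \<Union>D \<Longrightarrow> \<Union>D \<subseteq> S \<Longrightarrow> (\<Sum>K\<in>D. measure lborel K) < \<delta>1 \<Longrightarrow>
        (\<Sum>K\<in>D. \<bar>F1 (Sup K) - F1 (Inf K)\<bar>) < e"
    using abs_continuous_onD[OF F1 e] by blast
  obtain \<delta>2 where \<delta>2: "0 < \<delta>2" "\<And>D. D division_of \<Union>D \<Longrightarrow> \<Union>D \<subseteq> S \<Longrightarrow> (\<Sum>K\<in>D. measure lborel K) < \<delta>2 \<Longrightarrow>
        (\<Sum>K\<in>D. \<bar>F2 (Sup K) - F2 (Inf K)\<bar>) < e"
    using abs_continuous_onD[OF F2 e] by blast
  show "\<exists>\<delta>>0. \<forall>D. D division_of \<Union>D \<and> \<Union>D \<subseteq> S \<and> (\<Sum>K\<in>D. measure lborel K) < \<delta> \<longrightarrow>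
      (\<Sum>K\<in>D. \<bar>G (Sup K) - G (Inf K)\<bar>) < \<epsilon>"
  proof (intro exI[of _ "min \<delta>1 \<delta>2"] conjI allI impI)
    fix D assume D: "D division_of \<Union>D \<and> \<Union>D \<subseteq> S \<and> (\<Sum>K\<in>D. measure lborel K) < min \<delta>1 \<delta>2"
    have "(\<Sum>K\<in>D. \<bar>G (Sup K) - G (Inf K)\<bar>)
        \<le> (\<Sum>K\<in>D. m * \<bar>F1 (Sup K) - F1 (Inf K)\<bar> + m * \<bar>F2 (Sup K) - F2 (Inf K)\<bar>)"
    proof (rule sum_mono)
      fix K assume K: "K \<in> D"
      have Ddiv: "D division_of \<Union>D" using D by blast
      obtain y z where yz: "K = {y..z}" "y \<le> z"
        using division_ofD(3)[OF Ddiv K] division_ofD(4)[OF Ddiv K] by auto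
      moreover have "{y..z} \<subseteq> S" using K D yz by blast
      ultimately have "\<bar>G (Sup K) - G (Inf K)\<bar> \<le> C * \<bar>F1 z - F1 y\<bar> + C * \<bar>F2 z - F2 y\<bar>"
        using dom[of y z] by (simp add: subset_iff)
      also have "\<dots> \<le> m * \<bar>F1 z - F1 y\<bar> + m * \<bar>F2 z - F2 y\<bar>"
        using m(2) by (intro add_mono mult_right_mono) simp_all
      finally show "\<bar>G (Sup K) - G (Inf K)\<bar>
          \<le> m * \<bar>F1 (Sup K) - F1 (Inf K)\<bar> + m * \<bar>F2 (Sup K) - F2 (Inf K)\<bar>"
        using yz by simp
    qed
    also have "\<dots> < m * e + m * e"
      unfolding sum.distrib sum_distrib_left[symmetric]
      using D m(1) by (intro add_strict_mono mult_strict_left_mono \<delta>1(2) \<delta>2(2)) simp_all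
    also have "\<dots> = \<epsilon>"
      using m unfolding e_def by (simp add: field_simps)
    finally show "(\<Sum>K\<in>D. \<bar>G (Sup K) - G (Inf K)\<bar>) < \<epsilon>" .
  qed (use \<delta>1(1) \<delta>2(1) in simp)
qed

lemma abs_continuous_on_diff:
  "abs_continuous_on S F \<Longrightarrow> abs_continuous_on S G \<Longrightarrow> abs_continuous_on S (\<lambda>x. F x - G x)"
  by (rule abs_continuous_on_dominated[where C = 1 and ?F1.0 = F and ?F2.0 = G]) auto

lemma abs_continuous_on_lt:
  assumes F: "abs_continuous_on S F" and \<epsilon>: "0 < \<epsilon>"
  shows "\<exists>\<delta>>0. \<forall>y z. y \<le> z \<longrightarrow> {y..z} \<subseteq> S \<longrightarrow> z - y < \<delta> \<longrightarrow> \<bar>F z - F y\<bar> < \<epsilon>"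
proof -
  obtain \<delta> where \<delta>: "0 < \<delta>" "\<And>D. D division_of \<Union>D \<Longrightarrow> \<Union>D \<subseteq> S \<Longrightarrow> (\<Sum>K\<in>D. measure lborel K) < \<delta> \<Longrightarrow>
        (\<Sum>K\<in>D. \<bar>F (Sup K) - F (Inf K)\<bar>) < \<epsilon>"
    using abs_continuous_onD[OF F \<epsilon>] by blast
  show ?thesis
  proof (intro exI[of _ \<delta>] conjI allI impI \<delta>(1))
    fix y z assume yz: "y \<le> z" "{y..z} \<subseteq> S" "z - y < \<delta>"
    have "{{y..z}} division_of \<Union>{{y..z}}"
      using yz(1) division_of_self[of y z] by simp
    from \<delta>(2)[OF this] yz show "\<bar>F z - F y\<bar> < \<epsilon>" by simp
  qed
qed

lemma abs_continuous_on_imp_continuous_on: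
  assumes F: "abs_continuous_on {c..d} F"
  shows "continuous_on {c..d} F"
  unfolding continuous_on_iff
proof (intro ballI allI impI)
  fix x \<epsilon> assume x: "x \<in> {c..d}" and "0 < (\<epsilon>::real)"
  obtain \<delta> where \<delta>: "0 < \<delta>"
    "\<And>y z. y \<le> z \<Longrightarrow> {y..z} \<subseteq> {c..d} \<Longrightarrow> z - y < \<delta> \<Longrightarrow> \<bar>F z - F y\<bar> < \<epsilon>"
    using abs_continuous_on_lt[OF F \<open>0 < \<epsilon>\<close>] by blast
  have "dist (F y) (F x) < \<epsilon>" if y: "y \<in> {c..d}" "dist y x < \<delta>" for y
  proof (cases "x \<le> y")
    case True
    then show ?thesis using \<delta>(2)[of x y] x y by (auto simp: dist_real_def)
  next
    case False
    then show ?thesis using \<delta>(2)[of y x] x y by (auto simp: dist_real_def)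
  qed
  with \<delta>(1) show "\<exists>\<delta>>0. \<forall>y\<in>{c..d}. dist y x < \<delta> \<longrightarrow> dist (F y) (F x) < \<epsilon>" by blast
qed

text \<open>Increments of an absolutely continuous function, bounded finely at almost every point by \<open>W\<close>, are
  bounded globally: the cells of the division that are not controlled have small total length, and
  contribute at most \<open>\<epsilon>\<close> by absolute continuity.\<close>

lemma abs_continuous_increment_le:
  assumes cd: "c < d" and X: "abs_continuous_on {c..d} X" and N: "negligible N" and \<epsilon>: "0 < \<epsilon>"
    and fine: "\<And>x \<delta>. c < x \<Longrightarrow> x < d \<Longrightarrow> x \<notin> N \<Longrightarrow> 0 < \<delta> \<Longrightarrow>
        \<exists>y z. c \<le> y \<and> z \<le> d \<and> y < z \<and> y \<le> x \<and> x \<le> z \<and> z - y < \<delta> \<and> X z - X y \<le> W y z + \<epsilon> * (z - y)"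
  shows "\<exists>P. P division_of \<Union>P \<and> \<Union>P \<subseteq> {c..d} \<and>
    X d - X c \<le> (\<Sum>K\<in>P. W (Inf K) (Sup K)) + \<epsilon> * (d - c) + \<epsilon>"
proof -
  obtain \<delta> where \<delta>: "0 < \<delta>" "\<And>D. D division_of \<Union>D \<Longrightarrow> \<Union>D \<subseteq> {c..d} \<Longrightarrow> (\<Sum>K\<in>D. measure lborel K) < \<delta> \<Longrightarrow>
        (\<Sum>K\<in>D. \<bar>X (Sup K) - X (Inf K)\<bar>) < \<epsilon>"
    using abs_continuous_onD[OF X \<epsilon>] by blast
  have "\<exists>P D. P \<subseteq> D \<and> D division_of {c..d} \<and>
      (\<forall>K\<in>P. \<exists>y z. y < z \<and> K = {y..z} \<and> X z - X y \<le> W y z + \<epsilon> * (z - y)) \<and>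
      (\<Sum>K\<in>D - P. measure lborel K) < \<delta>"
  proof (rule vitali_division[OF cd N \<delta>(1)])
    fix x \<theta> :: real assume "c < x" "x < d" "x \<notin> N" "0 < \<theta>"
    from fine[OF this]
    show "\<exists>y z. c \<le> y \<and> z \<le> d \<and> y < z \<and> y \<le> x \<and> x \<le> z \<and> z - y < \<theta> \<and> X z - X y \<le> W y z + \<epsilon> * (z - y)" .
  qed
  then obtain P D where PD: "P \<subseteq> D" "D division_of {c..d}"
    "\<forall>K\<in>P. \<exists>y z. y < z \<and> K = {y..z} \<and> X z - X y \<le> W y z + \<epsilon> * (z - y)"
    "(\<Sum>K\<in>D - P. measure lborel K) < \<delta>"
    by (elim exE conjE)
  have fin: "finite D" using PD(2) by (rule division_of_finite)
  have U: "\<Union>D = {c..d}" using PD(2) by (rule division_ofD(6))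
  have "(D - P) division_of \<Union>(D - P)"
    by (rule division_of_subset[of D]) (use PD(2) U in simp_all)
  moreover have "\<Union>(D - P) \<subseteq> {c..d}" unfolding U[symmetric] by blast
  ultimately have 1: "(\<Sum>K\<in>D - P. X (Sup K) - X (Inf K)) \<le> \<epsilon>"
    using \<delta>(2)[OF _ _ PD(4)] sum_abs[of "\<lambda>K. X (Sup K) - X (Inf K)" "D - P"] by linarith
  have "(\<Sum>K\<in>P. X (Sup K) - X (Inf K)) \<le> (\<Sum>K\<in>P. W (Inf K) (Sup K) + \<epsilon> * measure lborel K)"
  proof (rule sum_mono)
    fix K assume "K \<in> P"
    then obtain y z where "y < z" "K = {y..z}" "X z - X y \<le> W y z + \<epsilon> * (z - y)"
      using PD(3) by blast
    then show "X (Sup K) - X (Inf K) \<le> W (Inf K) (Sup K) + \<epsilon> * measure lborel K" by simp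
  qed
  also have "\<dots> = (\<Sum>K\<in>P. W (Inf K) (Sup K)) + \<epsilon> * (\<Sum>K\<in>P. measure lborel K)"
    by (simp add: sum.distrib sum_distrib_left)
  finally have 2: "(\<Sum>K\<in>P. X (Sup K) - X (Inf K)) \<le> (\<Sum>K\<in>P. W (Inf K) (Sup K)) + \<epsilon> * (\<Sum>K\<in>P. measure lborel K)" .
  have 3: "\<epsilon> * (\<Sum>K\<in>P. measure lborel K) \<le> \<epsilon> * (d - c)"
  proof (rule mult_left_mono)
    have "(\<Sum>K\<in>P. measure lborel K) \<le> (\<Sum>K\<in>D. measure lborel K)"
      using PD(1) fin by (intro sum_mono2) auto
    also have "\<dots> = d - c"
      using additive_content_division[of D c d] PD(2) cd by simp
    finally show "(\<Sum>K\<in>P. measure lborel K) \<le> d - c" .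
  qed (use \<epsilon> in simp)
  have "X d - X c = (\<Sum>K\<in>D. X (Sup K) - X (Inf K))"
    using division_sum_telescope[OF _ PD(2), of X] cd by simp
  also have "\<dots> = (\<Sum>K\<in>D - P. X (Sup K) - X (Inf K)) + (\<Sum>K\<in>P. X (Sup K) - X (Inf K))"
    using fin PD(1) by (rule sum.subset_diff[rotated])
  finally have 4: "X d - X c \<le> (\<Sum>K\<in>P. W (Inf K) (Sup K)) + \<epsilon> * (d - c) + \<epsilon>"
    using 1 2 3 by linarith
  have "P division_of \<Union>P"
    by (rule division_of_subset[of D]) (use PD U in simp_all)
  moreover have "\<Union>P \<subseteq> {c..d}" unfolding U[symmetric] using PD(1) by blast
  ultimately show ?thesis using 4 by (intro exI[of _ P] conjI)
qed

lemma le_of_forall_eps: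
  fixes u v C :: real
  assumes "0 \<le> C" and "\<And>\<epsilon>. 0 < \<epsilon> \<Longrightarrow> u \<le> v + \<epsilon> * C + \<epsilon>"
  shows "u \<le> v"
proof (rule field_le_epsilon)
  fix e :: real assume "0 < e"
  define q where "q = e / (C + 1)"
  have "0 < q" using assms(1) \<open>0 < e\<close> by (simp add: q_def)
  from assms(2)[OF this] have "u \<le> v + q * (C + 1)"
    by (simp add: algebra_simps)
  moreover have "q * (C + 1) = e" using assms(1) by (simp add: q_def)
  ultimately show "u \<le> v + e" by simp
qed

text \<open>Only the lower derivate matters here: it suffices that some arbitrarily short intervals around almost
  every point have slope at most \<open>\<epsilon>\<close>. No differentiability is assumed.\<close>

lemma abs_continuous_le_of_slopes:
  assumes cd: "c < d" and F: "abs_continuous_on {c..d} F" and N: "negligible N"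
    and slope: "\<And>x \<delta> \<epsilon>. c < x \<Longrightarrow> x < d \<Longrightarrow> x \<notin> N \<Longrightarrow> 0 < \<delta> \<Longrightarrow> 0 < \<epsilon> \<Longrightarrow>
        \<exists>y z. c \<le> y \<and> z \<le> d \<and> y < z \<and> y \<le> x \<and> x \<le> z \<and> z - y < \<delta> \<and> F z - F y \<le> \<epsilon> * (z - y)"
  shows "F d \<le> F c"
proof -
  have "F d - F c \<le> 0"
  proof (rule le_of_forall_eps)
    fix \<epsilon> :: real assume \<epsilon>: "0 < \<epsilon>"
    have "\<exists>P. P division_of \<Union>P \<and> \<Union>P \<subseteq> {c..d} \<and>
      F d - F c \<le> (\<Sum>K\<in>P. (\<lambda>y z. 0) (Inf K) (Sup K)) + \<epsilon> * (d - c) + \<epsilon>"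
    proof (rule abs_continuous_increment_le[OF cd F N \<epsilon>])
      fix x \<theta> :: real assume "c < x" "x < d" "x \<notin> N" "0 < \<theta>"
      from slope[OF this \<epsilon>]
      show "\<exists>y z. c \<le> y \<and> z \<le> d \<and> y < z \<and> y \<le> x \<and> x \<le> z \<and> z - y < \<theta> \<and> F z - F y \<le> 0 + \<epsilon> * (z - y)"
        by simp
    qed
    then show "F d - F c \<le> 0 + \<epsilon> * (d - c) + \<epsilon>" by auto
  qed (use cd in simp)
  then show ?thesis by simp
qed

lemma sum_integral_division_le:
  fixes \<phi> :: "real \<Rightarrow> real"
  assumes \<phi>: "\<phi> integrable_on {c..d}" "\<And>x. x \<in> {c..d} \<Longrightarrow> 0 \<le> \<phi> x"
    and D: "D division_of \<Union>D" "\<Union>D \<subseteq> {c..d}"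
  shows "(\<Sum>K\<in>D. integral K \<phi>) \<le> integral {c..d} \<phi>"
proof -
  obtain D' where D': "D \<subseteq> D'" "D' division_of cbox c d"
    using partial_division_extend_interval[of D c d] D by auto
  have "(\<Sum>K\<in>D. integral K \<phi>) \<le> (\<Sum>K\<in>D'. integral K \<phi>)"
  proof (rule sum_mono2)
    show "finite D'" using D'(2) by (rule division_of_finite)
    fix K assume "K \<in> D' - D"
    then have K: "K \<in> D'" by blast
    have "K \<subseteq> {c..d}" "\<exists>a b. K = cbox a b"
      using division_ofD(2)[OF D'(2) K] division_ofD(4)[OF D'(2) K] by auto
    then show "0 \<le> integral K \<phi>"
      using \<phi>(2) by (intro integral_nonneg) (auto intro: integrable_subinterval_real[OF \<phi>(1)])
  qed (rule D')
  also have "\<dots> = integral {c..d} \<phi>"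
    using integral_combine_division_topdown[OF \<phi>(1)] D' by simp
  finally show ?thesis .
qed

section \<open>Indefinite integrals\<close>

lemma integral_tail_small:
  fixes g :: "real \<Rightarrow> real"
  assumes g: "g absolutely_integrable_on {c..d}" and "0 < e"
  shows "\<exists>M>0. (\<lambda>x. max 0 (\<bar>g x\<bar> - M)) integrable_on {c..d} \<and>
    integral {c..d} (\<lambda>x. max 0 (\<bar>g x\<bar> - M)) < e"
proof -
  have abs_g: "(\<lambda>x. \<bar>g x\<bar>) absolutely_integrable_on {c..d}"
    using absolutely_integrable_norm[OF g] by (simp add: comp_def)
  have int: "(\<lambda>x. max 0 (\<bar>g x\<bar> - real k)) absolutely_integrable_on {c..d}" for k
    by (intro absolutely_integrable_max_1 set_integral_diff abs_g
        absolutely_integrable_on_const) (auto simp: absolutely_integrable_on_const)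
  have "(\<lambda>k. integral {c..d} (\<lambda>x. max 0 (\<bar>g x\<bar> - real k))) \<longlonglongrightarrow> integral {c..d} (\<lambda>x. 0)"
  proof (rule dominated_convergence)
    show "(\<lambda>x. max 0 (\<bar>g x\<bar> - real k)) integrable_on {c..d}" for k
      using int[of k] by (simp add: absolutely_integrable_on_def)
    show "(\<lambda>x. \<bar>g x\<bar>) integrable_on {c..d}"
      using abs_g by (simp add: absolutely_integrable_on_def)
    show "(\<lambda>k. max 0 (\<bar>g x\<bar> - real k)) \<longlonglongrightarrow> 0" for x
    proof (rule tendsto_eventually)
      show "\<forall>\<^sub>F k in sequentially. max 0 (\<bar>g x\<bar> - real k) = 0"
        using eventually_ge_at_top[of "nat \<lceil>\<bar>g x\<bar>\<rceil>"] by eventually_elim linarith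
    qed
  qed auto
  from order_tendstoD(2)[OF this, of e] \<open>0 < e\<close>
  have "\<forall>\<^sub>F k in sequentially. integral {c..d} (\<lambda>x. max 0 (\<bar>g x\<bar> - real k)) < e" by simp
  with eventually_gt_at_top[of 0]
  have "\<forall>\<^sub>F k in sequentially. 0 < k \<and> integral {c..d} (\<lambda>x. max 0 (\<bar>g x\<bar> - real k)) < e"
    by eventually_elim simp
  then obtain k where "0 < k" "integral {c..d} (\<lambda>x. max 0 (\<bar>g x\<bar> - real k)) < e"
    by (auto simp: eventually_sequentially)
  then show ?thesis
    using int[of k] by (intro exI[of _ "real k"]) (simp add: absolutely_integrable_on_def)
qed

lemma abs_continuous_on_integral:
  fixes g :: "real \<Rightarrow> real"
  assumes g: "g absolutely_integrable_on {c..d}"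
  shows "abs_continuous_on {c..d} (\<lambda>x. integral {c..x} g)"
  unfolding abs_continuous_on_def
proof (intro allI impI)
  fix \<epsilon> :: real assume "0 < \<epsilon>"
  then obtain M where M: "0 < M" "(\<lambda>x. max 0 (\<bar>g x\<bar> - M)) integrable_on {c..d}"
      "integral {c..d} (\<lambda>x. max 0 (\<bar>g x\<bar> - M)) < \<epsilon> / 2"
    using integral_tail_small[OF g, of "\<epsilon> / 2"] by auto
  have gi: "g integrable_on {c..d}" and agi: "(\<lambda>x. \<bar>g x\<bar>) integrable_on {c..d}"
    using g by (auto simp: absolutely_integrable_on_def)
  show "\<exists>\<delta>>0. \<forall>D. D division_of \<Union>D \<and> \<Union>D \<subseteq> {c..d} \<and> (\<Sum>K\<in>D. measure lborel K) < \<delta> \<longrightarrow>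
      (\<Sum>K\<in>D. \<bar>integral {c..Sup K} g - integral {c..Inf K} g\<bar>) < \<epsilon>"
  proof (intro exI[of _ "\<epsilon> / (2 * M)"] conjI allI impI)
    fix D assume D: "D division_of \<Union>D \<and> \<Union>D \<subseteq> {c..d} \<and> (\<Sum>K\<in>D. measure lborel K) < \<epsilon> / (2 * M)"
    have Ddiv: "D division_of \<Union>D" using D by (elim conjE)
    have "(\<Sum>K\<in>D. \<bar>integral {c..Sup K} g - integral {c..Inf K} g\<bar>)
        \<le> (\<Sum>K\<in>D. integral K (\<lambda>x. max 0 (\<bar>g x\<bar> - M)) + M * measure lborel K)"
    proof (rule sum_mono)
      fix K assume K: "K \<in> D"
      obtain y z where yz: "K = {y..z}" "y \<le> z"
        using division_ofD(3)[OF Ddiv K] division_ofD(4)[OF Ddiv K] by auto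
      have sub: "{y..z} \<subseteq> {c..d}" using K D yz by blast
      then have cd: "c \<le> y" "z \<le> d" using yz(2) by auto
      have "g integrable_on {c..z}" by (rule integrable_subinterval_real[OF gi]) (use cd in auto)
      then have "integral {c..z} g - integral {c..y} g = integral {y..z} g"
        using Henstock_Kurzweil_Integration.integral_combine[of c y z g] cd yz(2) by simp
      also have "\<bar>\<dots>\<bar> \<le> integral {y..z} (\<lambda>x. max 0 (\<bar>g x\<bar> - M) + M)"
      proof -
        have "norm (integral {y..z} g) \<le> integral {y..z} (\<lambda>x. max 0 (\<bar>g x\<bar> - M) + M)"
          by (rule integral_norm_bound_integral)
            (auto intro!: integrable_add integrable_subinterval_real[OF gi sub] integrable_subinterval_real[OF M(2) sub])
        then show ?thesis by simp
      qed
      also have "\<dots> = integral {y..z} (\<lambda>x. max 0 (\<bar>g x\<bar> - M)) + integral {y..z} (\<lambda>x. M)"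
        by (rule integral_add) (auto intro: integrable_subinterval_real[OF M(2) sub])
      also have "\<dots> = integral {y..z} (\<lambda>x. max 0 (\<bar>g x\<bar> - M)) + M * (z - y)"
        using yz(2) by simp
      finally show "\<bar>integral {c..Sup K} g - integral {c..Inf K} g\<bar>
          \<le> integral K (\<lambda>x. max 0 (\<bar>g x\<bar> - M)) + M * measure lborel K"
        using yz by simp
    qed
    also have "\<dots> = (\<Sum>K\<in>D. integral K (\<lambda>x. max 0 (\<bar>g x\<bar> - M))) + M * (\<Sum>K\<in>D. measure lborel K)"
      by (simp add: sum.distrib sum_distrib_left)
    also have "\<dots> < \<epsilon> / 2 + M * (\<epsilon> / (2 * M))"
    proof (rule add_strict_mono)
      have "(\<Sum>K\<in>D. integral K (\<lambda>x. max 0 (\<bar>g x\<bar> - M))) \<le> integral {c..d} (\<lambda>x. max 0 (\<bar>g x\<bar> - M))"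
        using D by (intro sum_integral_division_le M(2)) simp_all
      with M(3) show "(\<Sum>K\<in>D. integral K (\<lambda>x. max 0 (\<bar>g x\<bar> - M))) < \<epsilon> / 2" by linarith
      show "M * (\<Sum>K\<in>D. measure lborel K) < M * (\<epsilon> / (2 * M))"
        using D M(1) by (intro mult_strict_left_mono) simp_all
    qed
    also have "\<dots> = \<epsilon>" using M(1) by simp
    finally show "(\<Sum>K\<in>D. \<bar>integral {c..Sup K} g - integral {c..Inf K} g\<bar>) < \<epsilon>" .
  qed (use M(1) \<open>0 < \<epsilon>\<close> in simp)
qed

text \<open>Lebesgue's differentiation theorem on an interval, with two-sided derivative. The one-sided statement
  is applied to \<open>g\<close> and to its reflection.\<close>

lemma integral_has_derivative_ae:
  fixes g :: "real \<Rightarrow> real"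
  assumes g: "g integrable_on {c..d}"
  shows "\<exists>N. negligible N \<and> (\<forall>x. c < x \<longrightarrow> x < d \<longrightarrow> x \<notin> N \<longrightarrow>
    ((\<lambda>t. integral {c..t} g) has_real_derivative g x) (at x))"
proof -
  define g0 where "g0 x = (if x \<in> {c..d} then g x else 0)" for x
  have g0_UNIV: "g0 integrable_on UNIV"
    unfolding g0_def using g integrable_restrict_UNIV by blast
  have g0: "g0 integrable_on cbox a b" for a b
    by (rule integrable_on_subcbox[OF g0_UNIV]) simp
  have g0': "(\<lambda>x. g0 (- x)) integrable_on cbox a b" for a b
    using g0[of "- b" "- a"] Henstock_Kurzweil_Integration.integrable_reflect_real[of g0 "-a" "-b"] by simp
  obtain N1 where N1: "negligible N1" "\<And>x e. x \<notin> N1 \<Longrightarrow> 0 < e \<Longrightarrow> \<exists>d>0. \<forall>h. 0 < h \<and> h < d \<longrightarrow>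
      norm (integral (cbox x (x + h *\<^sub>R One)) g0 /\<^sub>R h ^ DIM(real) - g0 x) < e"
    using integrable_ccontinuous_explicit[OF g0] by blast
  obtain N2 where N2: "negligible N2" "\<And>x e. x \<notin> N2 \<Longrightarrow> 0 < e \<Longrightarrow> \<exists>d>0. \<forall>h. 0 < h \<and> h < d \<longrightarrow>
      norm (integral (cbox x (x + h *\<^sub>R One)) (\<lambda>x. g0 (- x)) /\<^sub>R h ^ DIM(real) - g0 (- x)) < e"
    using integrable_ccontinuous_explicit[OF g0'] by blast
  show ?thesis
  proof (intro exI[of _ "N1 \<union> uminus ` N2"] conjI allI impI)
    have "negligible (uminus ` N2)"
      by (rule negligible_differentiable_image_negligible) (auto intro!: derivative_intros N2)
    with N1(1) show "negligible (N1 \<union> uminus ` N2)" by (rule negligible_Un)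
    fix x assume x: "c < x" "x < d" "x \<notin> N1 \<union> uminus ` N2"
    then have "x \<notin> N1" "- x \<notin> N2" by force+
    have eq: "integral {c..z} g - integral {c..y} g = integral {y..z} g0" if "c \<le> y" "y \<le> z" "z \<le> d" for y z
    proof -
      have "g integrable_on {c..z}" by (rule integrable_subinterval_real[OF g]) (use that in auto)
      then have "integral {c..z} g - integral {c..y} g = integral {y..z} g"
        using Henstock_Kurzweil_Integration.integral_combine[of c y z g] that by simp
      also have "\<dots> = integral {y..z} g0"
        by (rule integral_cong) (use that in \<open>auto simp: g0_def\<close>)
      finally show ?thesis .
    qed
    have "(\<lambda>y. (integral {c..y} g - integral {c..x} g) / (y - x)) \<midarrow>x\<rightarrow> g x"
      unfolding LIM_eq
    proof (intro allI impI)
      fix e :: real assume e: "0 < e"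
      obtain d1 where d1: "0 < d1" "\<And>h. 0 < h \<Longrightarrow> h < d1 \<Longrightarrow> \<bar>integral {x..x + h} g0 / h - g0 x\<bar> < e"
        using N1(2)[OF \<open>x \<notin> N1\<close> e] by (auto simp: divide_inverse mult.commute)
      obtain d2 where d2: "0 < d2" "\<And>h. 0 < h \<Longrightarrow> h < d2 \<Longrightarrow>
          \<bar>integral {- x..- x + h} (\<lambda>x. g0 (- x)) / h - g0 x\<bar> < e"
        using N2(2)[OF \<open>- x \<notin> N2\<close> e] by (auto simp: divide_inverse mult.commute)
      define s where "s = min (min d1 d2) (min (x - c) (d - x))"
      have "norm ((integral {c..y} g - integral {c..x} g) / (y - x) - g x) < e"
        if y: "y \<noteq> x" "norm (y - x) < s" for y
      proof (cases "x < y")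
        case True
        then have "y - x < d1" "y < d" using y(2) by (auto simp: s_def)
        then have "\<bar>integral {x..y} g0 / (y - x) - g0 x\<bar> < e" using d1(2)[of "y - x"] True by simp
        moreover have "integral {c..y} g - integral {c..x} g = integral {x..y} g0"
          using eq[of x y] x True \<open>y < d\<close> by simp
        ultimately show ?thesis using x by (simp add: g0_def)
      next
        case False
        then have *: "x - y < d2" "c < y" "y < x" using y by (auto simp: s_def)
        then have "\<bar>integral {- x..- y} (\<lambda>x. g0 (- x)) / (x - y) - g0 x\<bar> < e" using d2(2)[of "x - y"] by simp
        moreover have "integral {c..x} g - integral {c..y} g = integral {y..x} g0"
          using eq[of y x] x * by simp
        moreover have "(integral {c..y} g - integral {c..x} g) / (y - x) = (integral {c..x} g - integral {c..y} g) / (x - y)"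
          by (metis minus_diff_eq minus_divide_divide)
        moreover have "integral {- x..- y} (\<lambda>x. g0 (- x)) = integral {y..x} g0"
          by (rule Henstock_Kurzweil_Integration.integral_reflect_real)
        moreover have "g0 x = g x" using x by (simp add: g0_def)
        ultimately show ?thesis by simp
      qed
      moreover have "0 < s" using d1 d2 x by (simp add: s_def)
      ultimately show "\<exists>s>0. \<forall>y. y \<noteq> x \<and> norm (y - x) < s \<longrightarrow>
          norm ((integral {c..y} g - integral {c..x} g) / (y - x) - g x) < e" by blast
    qed
    then show "((\<lambda>t. integral {c..t} g) has_real_derivative g x) (at x)"
      by (simp add: has_field_derivative_iff)
  qed
qed

section \<open>Densities of absolutely continuous functions\<close>

text \<open>The lower limit of \<open>|s n|\<close> is attained, up to sign, as a limit point of \<open>s\<close> itself. The formula for the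
  sign is explicit so that it depends measurably on parameters.\<close>

lemma frequently_near_signed_liminf:
  fixes s :: "nat \<Rightarrow> real"
  assumes lim: "liminf (\<lambda>n. ennreal \<bar>s n\<bar>) = ennreal \<alpha>" and "0 \<le> \<alpha>" and e: "0 < e"
    and g: "g = (if liminf (\<lambda>n. ennreal \<bar>s n - \<alpha>\<bar>) = 0 then \<alpha> else - \<alpha>)"
  shows "\<exists>\<^sub>F n in sequentially. \<bar>s n - g\<bar> < e"
proof (cases "liminf (\<lambda>n. ennreal \<bar>s n - \<alpha>\<bar>) = 0")
  case True
  have "\<exists>\<^sub>F n in sequentially. \<bar>s n - \<alpha>\<bar> < e"
  proof (rule ccontr)
    assume "\<not> ?thesis"
    then have "\<forall>\<^sub>F n in sequentially. ennreal e \<le> ennreal \<bar>s n - \<alpha>\<bar>"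
      unfolding not_frequently by eventually_elim (auto intro: ennreal_leI)
    then have "ennreal e \<le> liminf (\<lambda>n. ennreal \<bar>s n - \<alpha>\<bar>)"
      by (rule Liminf_bounded)
    then show False using True e by simp
  qed
  then show ?thesis using True g by simp
next
  case False
  then have "0 < liminf (\<lambda>n. ennreal \<bar>s n - \<alpha>\<bar>)" by (simp add: zero_less_iff_neq_zero)
  then obtain r where r: "0 < r" "r < liminf (\<lambda>n. ennreal \<bar>s n - \<alpha>\<bar>)"
    using dense by blast
  then have "r \<noteq> top" by auto
  then obtain q where q: "r = ennreal q" "0 < q"
    using r(1) by (cases r) auto
  have far: "\<forall>\<^sub>F n in sequentially. q < \<bar>s n - \<alpha>\<bar>"
    using less_LiminfD[OF r(2)] unfolding q(1)
    by eventually_elim (use q(2) in \<open>auto simp: ennreal_less_iff\<close>)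
  define e' where "e' = min e q"
  have e': "0 < e'" using e q by (simp add: e'_def)
  have low: "\<forall>\<^sub>F n in sequentially. \<alpha> - e' < \<bar>s n\<bar>"
  proof (cases "\<alpha> - e' < 0")
    case True
    then show ?thesis by (intro always_eventually allI) linarith
  next
    case False
    then have "ennreal (\<alpha> - e') < liminf (\<lambda>n. ennreal \<bar>s n\<bar>)"
      unfolding lim using e' by (simp add: ennreal_less_iff)
    from less_LiminfD[OF this] show ?thesis
      by eventually_elim (use False in \<open>auto simp: ennreal_less_iff\<close>)
  qed
  have "\<exists>\<^sub>F n in sequentially. \<bar>s n\<bar> < \<alpha> + e'"
  proof (rule ccontr)
    assume "\<not> ?thesis"
    then have "\<forall>\<^sub>F n in sequentially. ennreal (\<alpha> + e') \<le> ennreal \<bar>s n\<bar>"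
      unfolding not_frequently by eventually_elim (auto intro: ennreal_leI)
    then have "ennreal (\<alpha> + e') \<le> liminf (\<lambda>n. ennreal \<bar>s n\<bar>)"
      by (rule Liminf_bounded)
    then show False unfolding lim using e' \<open>0 \<le> \<alpha>\<close> by simp
  qed
  then have "\<exists>\<^sub>F n in sequentially. \<bar>s n\<bar> < \<alpha> + e' \<and> (\<alpha> - e' < \<bar>s n\<bar> \<and> q < \<bar>s n - \<alpha>\<bar>)"
    by (rule frequently_eventually_frequently) (use low far in eventually_elim, simp)
  then show ?thesis
  proof (rule frequently_elim1)
    fix n assume "\<bar>s n\<bar> < \<alpha> + e' \<and> \<alpha> - e' < \<bar>s n\<bar> \<and> q < \<bar>s n - \<alpha>\<bar>"
    moreover have "e' \<le> e" "e' \<le> q" by (simp_all add: e'_def)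
    ultimately have "\<bar>s n + \<alpha>\<bar> < e" by linarith
    then show "\<bar>s n - g\<bar> < e" using False g by simp
  qed
qed

lemma SUP_min_of_nat_ennreal:
  fixes A :: ennreal
  shows "(SUP n. min A (of_nat n)) = A"
proof (cases "A = top")
  case True
  then show ?thesis using ennreal_SUP_of_nat_eq_top by (simp add: min_def top_unique)
next
  case False
  then obtain n where "A < of_nat n" using ennreal_Ex_less_of_nat[of A] by (auto simp: less_top)
  then have "min A (of_nat n) = A" by (simp add: min_absorb1 less_imp_le)
  then show ?thesis by (intro antisym SUP_least) (auto intro: SUP_upper2[of n])
qed

lemma derivative_imp_forward_slopes:
  assumes "(X has_real_derivative D) (at x)"
  shows "(\<lambda>n. real (Suc n) * (X (x + 1 / real (Suc n)) - X x)) \<longlonglongrightarrow> D"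
proof -
  have "(\<lambda>n. x + 1 / real (Suc n)) \<longlonglongrightarrow> x + 0"
    by (intro tendsto_intros LIMSEQ_inverse_real_of_nat[unfolded inverse_eq_divide])
  then have "filterlim (\<lambda>n. x + 1 / real (Suc n)) (at x) sequentially"
    by (auto simp: filterlim_at)
  from filterlim_compose[OF assms[unfolded has_field_derivative_iff] this]
  show ?thesis by (simp add: mult.commute)
qed

text \<open>On an interval over which \<open>F\<close> has variation at most \<open>1\<close>, the function \<open>F\<close> has an integrable density. Put
  \<open>a = liminf n |F(x + 1/n) - F x|\<close>. Each truncation of \<open>a\<close> has integral at most the variation of \<open>F\<close>, by
  \<open>abs_continuous_increment_le\<close>, so \<open>a\<close> is integrable. The density is \<open>a\<close> or \<open>- a\<close>, whichever is a limit
  point of the forward difference quotients; the indefinite integral of this function then differs from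
  \<open>F\<close> by a function whose slopes have limit point \<open>0\<close> almost everywhere, that is, by a constant.\<close>

lemma abs_continuous_local_density:
  assumes cd: "c < d" and F: "abs_continuous_on {c..d} F"
    and var: "\<And>D. D division_of \<Union>D \<Longrightarrow> \<Union>D \<subseteq> {c..d} \<Longrightarrow> (\<Sum>K\<in>D. \<bar>F (Sup K) - F (Inf K)\<bar>) \<le> 1"
  shows "\<exists>g. g absolutely_integrable_on {c..d} \<and> (\<forall>t\<in>{c..d}. integral {c..t} g = F t - F c)"
proof -
  define Fh where "Fh x = F (max c (min d x))" for x
  have Fh_eq: "Fh x = F x" if "x \<in> {c..d}" for x using that by (simp add: Fh_def)
  have "continuous_on UNIV Fh" unfolding Fh_def
    by (rule continuous_on_compose2[OF abs_continuous_on_imp_continuous_on[OF F]])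
      (use cd in \<open>auto intro!: continuous_intros\<close>)
  then have Fh_meas[measurable]: "Fh \<in> borel_measurable borel"
    by (rule borel_measurable_continuous_onI)
  define sl where "sl n x = real (Suc n) * (Fh (x + 1 / real (Suc n)) - Fh x)" for n x
  have sl_meas[measurable]: "sl n \<in> borel_measurable borel" for n
    unfolding sl_def by measurable
  define a where "a x = liminf (\<lambda>n. ennreal \<bar>sl n x\<bar>)" for x
  have a_meas[measurable]: "a \<in> borel_measurable borel"
    unfolding a_def by measurable

  have a_leb[measurable]: "a \<in> borel_measurable lebesgue"
    using a_meas by (simp add: measurable_completion)

  \<comment> \<open>intervals \<open>[x, x + 1/(n+1)]\<close> with infinitely many admissible \<open>n\<close> give a fine family at \<open>x\<close>\<close>
  have forward: "\<exists>y z. c \<le> y \<and> z \<le> t \<and> y < z \<and> y \<le> x \<and> x \<le> z \<and> z - y < \<delta> \<and> Q y z"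
    if x: "c < x" "x < t" "t \<le> d" "0 < \<delta>"
      and fr: "\<exists>\<^sub>F n in sequentially. R n"
      and Q: "\<And>n. R n \<Longrightarrow> x + 1 / real (Suc n) \<le> t \<Longrightarrow> Q x (x + 1 / real (Suc n))" for x t \<delta> Q R
  proof -
    have "(\<lambda>n. 1 / real (Suc n)) \<longlonglongrightarrow> 0"
      by (rule LIMSEQ_inverse_real_of_nat[unfolded inverse_eq_divide])
    then have "\<forall>\<^sub>F n in sequentially. 1 / real (Suc n) < min \<delta> (t - x)"
      by (rule order_tendstoD) (use x in simp)
    from frequently_ex[OF frequently_eventually_frequently[OF fr this]]
    obtain n where n: "R n" "1 / real (Suc n) < min \<delta> (t - x)" by blast
    show ?thesis
      by (intro exI[of _ x] exI[of _ "x + 1 / real (Suc n)"]) (use n x Q[OF n(1)] in simp)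
  qed

  have bound: "integral {c..d} (\<lambda>x. enn2real (min (a x) (of_nat M))) \<le> 1
      \<and> (\<lambda>x. enn2real (min (a x) (of_nat M))) absolutely_integrable_on {c..d}" for M
  proof -
    define am where "am x = enn2real (min (a x) (of_nat M))" for x
    have am_bound: "0 \<le> am x" "am x \<le> real M" for x
      using enn2real_mono[of "min (a x) (of_nat M)" "of_nat M"]
      by (auto simp: am_def ennreal_of_nat_eq_real_of_nat)
    have am_le: "ennreal (am x) \<le> a x" for x
    proof -
      have "min (a x) (of_nat M) < top" by (simp add: min_less_iff_disj of_nat_less_top)
      then have "ennreal (am x) = min (a x) (of_nat M)" unfolding am_def by simp
      then show ?thesis by simp
    qed
    have am_int: "am absolutely_integrable_on {c..d}"
    proof (rule measurable_bounded_by_integrable_imp_absolutely_integrable)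
      have "am \<in> borel_measurable borel" unfolding am_def by measurable
      then have "am \<in> borel_measurable lebesgue" by (simp add: measurable_completion)
      then show "am \<in> borel_measurable (lebesgue_on {c..d})" by (rule measurable_restrict_space1)
      show "(\<lambda>x. real M) integrable_on {c..d}" by (rule integrable_const_ivl)
    qed (use am_bound in auto)
    define X where "X t = integral {c..t} am" for t
    have X: "abs_continuous_on {c..d} X" unfolding X_def by (rule abs_continuous_on_integral[OF am_int])
    obtain N where N: "negligible N" "\<And>x. c < x \<Longrightarrow> x < d \<Longrightarrow> x \<notin> N \<Longrightarrow> (X has_real_derivative am x) (at x)"
      using integral_has_derivative_ae[of am c d] am_int unfolding X_def absolutely_integrable_on_def by blast
    have "X d \<le> 1"
    proof (rule le_of_forall_eps)
      fix \<epsilon> :: real assume \<epsilon>: "0 < \<epsilon>"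
      have "\<exists>P. P division_of \<Union>P \<and> \<Union>P \<subseteq> {c..d} \<and>
          X d - X c \<le> (\<Sum>K\<in>P. (\<lambda>y z. \<bar>F z - F y\<bar>) (Inf K) (Sup K)) + \<epsilon> * (d - c) + \<epsilon>"
      proof (rule abs_continuous_increment_le[OF cd X N(1) \<epsilon>])
        fix x \<delta> :: real assume x: "c < x" "x < d" "x \<notin> N" "0 < \<delta>"
        have "\<forall>\<^sub>F n in sequentially. real (Suc n) * (X (x + 1 / real (Suc n)) - X x) < am x + \<epsilon> / 2"
          by (rule order_tendstoD(2)[OF derivative_imp_forward_slopes[OF N(2)[OF x(1-3)]]]) (use \<epsilon> in simp)
        moreover have "\<forall>\<^sub>F n in sequentially. am x - \<epsilon> / 2 < \<bar>sl n x\<bar>"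
        proof (cases "am x - \<epsilon> / 2 < 0")
          case True
          then show ?thesis by (intro always_eventually allI) linarith
        next
          case False
          then have "ennreal (am x - \<epsilon> / 2) < ennreal (am x)"
            using \<epsilon> by (simp add: ennreal_less_iff)
          also have "\<dots> \<le> liminf (\<lambda>n. ennreal \<bar>sl n x\<bar>)" using am_le unfolding a_def .
          finally show ?thesis
            using False by (elim less_LiminfD[THEN eventually_mono]) (simp add: ennreal_less_iff)
        qed
        ultimately have ev: "\<forall>\<^sub>F n in sequentially.
            real (Suc n) * (X (x + 1 / real (Suc n)) - X x) \<le> \<bar>sl n x\<bar> + \<epsilon>"
          by eventually_elim linarith
        show "\<exists>y z. c \<le> y \<and> z \<le> d \<and> y < z \<and> y \<le> x \<and> x \<le> z \<and> z - y < \<delta> \<and>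
            X z - X y \<le> \<bar>F z - F y\<bar> + \<epsilon> * (z - y)"
        proof (rule forward[OF x(1,2) order_refl x(4) eventually_frequently[OF _ ev]])
          fix n assume le: "real (Suc n) * (X (x + 1 / real (Suc n)) - X x) \<le> \<bar>sl n x\<bar> + \<epsilon>"
            and n: "x + 1 / real (Suc n) \<le> d"
          have "x + 1 / real (Suc n) \<in> {c..d}" using n x by (auto intro: order_trans[of c x])
          then have "\<bar>sl n x\<bar> = real (Suc n) * \<bar>F (x + 1 / real (Suc n)) - F x\<bar>"
            using x by (simp only: sl_def Fh_eq abs_mult) (simp add: Fh_eq)
          moreover have "real (Suc n) * (\<epsilon> * (1 / real (Suc n))) = \<epsilon>" by simp
          ultimately have "real (Suc n) * (X (x + 1 / real (Suc n)) - X x)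
              \<le> real (Suc n) * (\<bar>F (x + 1 / real (Suc n)) - F x\<bar> + \<epsilon> * (1 / real (Suc n)))"
            unfolding distrib_left using le by linarith
          then have "X (x + 1 / real (Suc n)) - X x \<le> \<bar>F (x + 1 / real (Suc n)) - F x\<bar> + \<epsilon> * (1 / real (Suc n))"
            by (subst (asm) mult_le_cancel_left_pos) simp_all
          then show "X (x + 1 / real (Suc n)) - X x
              \<le> \<bar>F (x + 1 / real (Suc n)) - F x\<bar> + \<epsilon> * (x + 1 / real (Suc n) - x)" by simp
        qed simp
      qed
      then obtain P where P: "P division_of \<Union>P" "\<Union>P \<subseteq> {c..d}"
        "X d - X c \<le> (\<Sum>K\<in>P. \<bar>F (Sup K) - F (Inf K)\<bar>) + \<epsilon> * (d - c) + \<epsilon>"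
        by (elim exE conjE)
      from var[OF P(1,2)] P(3) show "X d \<le> 1 + \<epsilon> * (d - c) + \<epsilon>"
        by (simp add: X_def)
    qed (use cd in simp)
    then show ?thesis using am_int unfolding X_def am_def by simp
  qed

  have nn: "(\<integral>\<^sup>+x. a x * indicator {c..d} x \<partial>lebesgue) \<le> 1"
  proof -
    have "(\<integral>\<^sup>+x. a x * indicator {c..d} x \<partial>lebesgue)
        = (\<integral>\<^sup>+x. (SUP M. min (a x) (of_nat M) * indicator {c..d} x) \<partial>lebesgue)"
      by (simp add: SUP_mult_right_ennreal[symmetric] SUP_min_of_nat_ennreal)
    also have "\<dots> = (SUP M. \<integral>\<^sup>+x. min (a x) (of_nat M) * indicator {c..d} x \<partial>lebesgue)"
    proof (rule nn_integral_monotone_convergence_SUP)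
      show "incseq (\<lambda>M x. min (a x) (of_nat M) * indicator {c..d} x)"
        by (auto simp: incseq_def le_fun_def min_le_iff_disj intro!: mult_right_mono)
      show "(\<lambda>x. min (a x) (of_nat M) * indicator {c..d} x) \<in> borel_measurable lebesgue" for M
      proof -
        have "(\<lambda>x. min (a x) (of_nat M) * indicator {c..d} x) \<in> borel_measurable borel" by measurable
        then show ?thesis by (simp add: measurable_completion)
      qed
    qed
    also have "\<dots> \<le> 1"
    proof (rule SUP_least)
      fix M
      have "(\<integral>\<^sup>+x. min (a x) (of_nat M) * indicator {c..d} x \<partial>lebesgue)
          = (\<integral>\<^sup>+x. ennreal (indicator {c..d} x *\<^sub>R enn2real (min (a x) (of_nat M))) \<partial>lebesgue)"
        by (intro nn_integral_cong) (auto simp: indicator_def min_less_iff_disj of_nat_less_top)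
      also have "\<dots> = ennreal (LINT x|lebesgue. indicator {c..d} x *\<^sub>R enn2real (min (a x) (of_nat M)))"
        using bound[of M] by (intro nn_integral_eq_integral) (auto simp: set_integrable_def)
      also have "\<dots> \<le> 1"
        using bound[of M] set_lebesgue_integral_eq_integral(2)[of "{c..d}" "\<lambda>x. enn2real (min (a x) (of_nat M))"]
        by (simp add: set_lebesgue_integral_def)
      finally show "(\<integral>\<^sup>+x. min (a x) (of_nat M) * indicator {c..d} x \<partial>lebesgue) \<le> 1" .
    qed
    finally show ?thesis .
  qed

  define N0 where "N0 = {x \<in> {c..d}. a x = top}"
  have N0: "negligible N0"
  proof -
    have "AE x in lebesgue. a x * indicator {c..d} x \<noteq> top"
      unfolding infinity_ennreal_def[symmetric]
    proof (rule nn_integral_PInf_AE)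
      have "(\<lambda>x. a x * indicator {c..d} x) \<in> borel_measurable borel" by measurable
      then show "(\<lambda>x. a x * indicator {c..d} x) \<in> borel_measurable lebesgue"
        by (simp add: measurable_completion)
    qed (use nn in \<open>auto simp: top_unique\<close>)
    then have "AE x in lebesgue. x \<notin> N0"
      by eventually_elim (auto simp: N0_def indicator_def)
    then show ?thesis
      by (simp add: eventually_ae_filter_negligible) (metis (no_types, lifting) mem_Collect_eq negligible_subset subsetI)
  qed
  define \<alpha> where "\<alpha> x = enn2real (a x)" for x
  define g where "g x = (if liminf (\<lambda>n. ennreal \<bar>sl n x - \<alpha> x\<bar>) = 0 then \<alpha> x else - \<alpha> x)" for x
  have \<alpha>_meas[measurable]: "\<alpha> \<in> borel_measurable borel" unfolding \<alpha>_def by measurable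
  have g_meas[measurable]: "g \<in> borel_measurable borel" unfolding g_def by measurable
  have g_leb[measurable]: "g \<in> borel_measurable lebesgue"
    using g_meas by (simp add: measurable_completion)
  have g_int: "g absolutely_integrable_on {c..d}"
    unfolding set_integrable_def
  proof (rule integrableI_bounded)
    have "(\<integral>\<^sup>+x. ennreal (norm (indicator {c..d} x *\<^sub>R g x)) \<partial>lebesgue)
        \<le> (\<integral>\<^sup>+x. a x * indicator {c..d} x \<partial>lebesgue)"
      by (intro nn_integral_mono)
        (auto simp: indicator_def g_def \<alpha>_def ennreal_enn2real_if)
    also have "\<dots> \<le> 1" by (rule nn)
    finally show "(\<integral>\<^sup>+x. ennreal (norm (indicator {c..d} x *\<^sub>R g x)) \<partial>lebesgue) < \<infinity>"
      by (rule le_less_trans) simp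
    have "(\<lambda>x. indicator {c..d} x *\<^sub>R g x) \<in> borel_measurable borel" by measurable
    then show "(\<lambda>x. indicator {c..d} x *\<^sub>R g x) \<in> borel_measurable lebesgue"
      by (simp add: measurable_completion)
  qed
  define X where "X t = integral {c..t} g" for t
  have X: "abs_continuous_on {c..d} X" unfolding X_def by (rule abs_continuous_on_integral[OF g_int])
  obtain N where N: "negligible N" "\<And>x. c < x \<Longrightarrow> x < d \<Longrightarrow> x \<notin> N \<Longrightarrow> (X has_real_derivative g x) (at x)"
    using integral_has_derivative_ae[of g c d] g_int unfolding X_def absolutely_integrable_on_def by blast

  have close: "\<exists>y z. c \<le> y \<and> z \<le> t \<and> y < z \<and> y \<le> x \<and> x \<le> z \<and> z - y < \<delta> \<and>
      \<bar>(F z - X z) - (F y - X y)\<bar> \<le> \<epsilon> * (z - y)"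
    if x: "c < x" "x < t" "t \<le> d" "x \<notin> N \<union> N0" "0 < \<delta>" "0 < \<epsilon>" for x t \<delta> \<epsilon>
  proof -
    have "a x \<noteq> top" using x by (auto simp: N0_def)
    then have "liminf (\<lambda>n. ennreal \<bar>sl n x\<bar>) = ennreal (\<alpha> x)"
      by (simp add: \<alpha>_def a_def[symmetric] less_top)
    from frequently_near_signed_liminf[OF this _ _ g_def, of "\<epsilon> / 2"]
    have 1: "\<exists>\<^sub>F n in sequentially. \<bar>sl n x - g x\<bar> < \<epsilon> / 2" using x(6) by (simp add: \<alpha>_def)
    have D: "(X has_real_derivative g x) (at x)" using N(2)[of x] x by auto
    have "\<forall>\<^sub>F n in sequentially. \<bar>real (Suc n) * (X (x + 1 / real (Suc n)) - X x) - g x\<bar> < \<epsilon> / 2"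
      using tendstoD[OF derivative_imp_forward_slopes[OF D], of "\<epsilon> / 2"] x(6) by (simp add: dist_real_def)
    from frequently_eventually_frequently[OF 1 this]
    have fr: "\<exists>\<^sub>F n in sequentially. \<bar>sl n x - real (Suc n) * (X (x + 1 / real (Suc n)) - X x)\<bar> \<le> \<epsilon>"
      by (rule frequently_elim1) linarith
    show ?thesis
    proof (rule forward[OF x(1-3,5) fr])
      fix n assume le: "\<bar>sl n x - real (Suc n) * (X (x + 1 / real (Suc n)) - X x)\<bar> \<le> \<epsilon>"
        and n: "x + 1 / real (Suc n) \<le> t"
      define z where "z = x + 1 / real (Suc n)"
      have "x < z" by (simp add: z_def)
      then have "z \<in> {c..d}" "x \<in> {c..d}" using n x unfolding z_def[symmetric] by auto
      then have "sl n x - real (Suc n) * (X z - X x) = real (Suc n) * ((F z - X z) - (F x - X x))"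
        unfolding sl_def z_def[symmetric] by (simp only: Fh_eq) (simp only: right_diff_distrib)
      with le have "real (Suc n) * \<bar>(F z - X z) - (F x - X x)\<bar> \<le> \<epsilon>"
        unfolding z_def[symmetric] by (simp only: abs_mult abs_of_nat)
      then have "\<bar>(F z - X z) - (F x - X x)\<bar> \<le> \<epsilon> * (z - x)"
        unfolding z_def by (simp add: field_simps)
      then show "\<bar>(F (x + 1 / real (Suc n)) - X (x + 1 / real (Suc n))) - (F x - X x)\<bar>
          \<le> \<epsilon> * (x + 1 / real (Suc n) - x)"
        unfolding z_def by simp
    qed
  qed
  have "X t = F t - F c" if t: "t \<in> {c..d}" for t
  proof (cases "t = c")
    case True
    then show ?thesis by (simp add: X_def)
  next
    case False
    then have ct: "c < t" "t \<le> d" using t by auto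
    have NN: "negligible (N \<union> N0)" using N(1) N0 by (rule negligible_Un)
    have sub: "{c..t} \<subseteq> {c..d}" using ct by auto
    note AC = abs_continuous_on_subset[OF F sub] abs_continuous_on_subset[OF X sub]
    have "F t - X t \<le> F c - X c"
    proof (rule abs_continuous_le_of_slopes[OF ct(1) _ NN])
      show "abs_continuous_on {c..t} (\<lambda>t. F t - X t)" by (intro abs_continuous_on_diff AC)
      fix x \<delta> \<epsilon> :: real assume "c < x" "x < t" "x \<notin> N \<union> N0" "0 < \<delta>" "0 < \<epsilon>"
      from close[OF this(1,2) ct(2) this(3-5)]
      show "\<exists>y z. c \<le> y \<and> z \<le> t \<and> y < z \<and> y \<le> x \<and> x \<le> z \<and> z - y < \<delta> \<and>
          (F z - X z) - (F y - X y) \<le> \<epsilon> * (z - y)" by (meson abs_le_D1)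
    qed
    moreover have "X t - F t \<le> X c - F c"
    proof (rule abs_continuous_le_of_slopes[OF ct(1) _ NN])
      show "abs_continuous_on {c..t} (\<lambda>t. X t - F t)" by (intro abs_continuous_on_diff AC)
      fix x \<delta> \<epsilon> :: real assume "c < x" "x < t" "x \<notin> N \<union> N0" "0 < \<delta>" "0 < \<epsilon>"
      from close[OF this(1,2) ct(2) this(3-5)] obtain y z where
        "c \<le> y \<and> z \<le> t \<and> y < z \<and> y \<le> x \<and> x \<le> z \<and> z - y < \<delta> \<and>
          \<bar>(F z - X z) - (F y - X y)\<bar> \<le> \<epsilon> * (z - y)" by blast
      then show "\<exists>y z. c \<le> y \<and> z \<le> t \<and> y < z \<and> y \<le> x \<and> x \<le> z \<and> z - y < \<delta> \<and>
          (X z - F z) - (X y - F y) \<le> \<epsilon> * (z - y)" by (intro exI[of _ y] exI[of _ z]) linarith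
    qed
    moreover have "X c = 0" by (simp add: X_def)
    ultimately show ?thesis by linarith
  qed
  with g_int show ?thesis unfolding X_def by blast
qed

section \<open>The fundamental theorem of calculus and closure properties\<close>

text \<open>Almost everywhere differentiability and the fundamental theorem of calculus for absolutely continuous
  functions. Short intervals have variation at most \<open>1\<close>; bisection extends the result to \<open>[c,d]\<close>.\<close>

lemma abs_continuous_FTC:
  assumes "c \<le> d" and F: "abs_continuous_on {c..d} F"
  shows "\<exists>N. negligible N \<and> (\<forall>x. c < x \<longrightarrow> x < d \<longrightarrow> x \<notin> N \<longrightarrow> (F has_real_derivative deriv F x) (at x)) \<and>
    deriv F absolutely_integrable_on {c..d} \<and> integral {c..d} (deriv F) = F d - F c"
proof -
  define \<Phi> where "\<Phi> y z \<longleftrightarrow> (\<exists>N. negligible N \<and>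
    (\<forall>x. y < x \<longrightarrow> x < z \<longrightarrow> x \<notin> N \<longrightarrow> (F has_real_derivative deriv F x) (at x)) \<and>
    deriv F absolutely_integrable_on {y..z} \<and> integral {y..z} (deriv F) = F z - F y)" for y z
  have trivial: "\<Phi> y y" for y
    unfolding \<Phi>_def using integrable_on_refl[of "deriv F" y] integrable_on_refl[of "\<lambda>x. \<bar>deriv F x\<bar>" y]
    by (intro exI[of _ "{}"]) (simp add: absolutely_integrable_on_def)
  have "c \<le> c \<and> d \<le> d \<longrightarrow> \<Phi> c d"
    using \<open>c \<le> d\<close>
  proof (induction rule: Bolzano[where P = "\<lambda>y z. c \<le> y \<and> z \<le> d \<longrightarrow> \<Phi> y z"])
    case (trans x y z)
    show ?case
    proof
      assume xz: "c \<le> x \<and> z \<le> d"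
      then have "\<Phi> x y" "\<Phi> y z" using trans by auto
      then obtain N1 N2 where
        1: "negligible N1" "\<forall>t. x < t \<longrightarrow> t < y \<longrightarrow> t \<notin> N1 \<longrightarrow> (F has_real_derivative deriv F t) (at t)"
          "deriv F absolutely_integrable_on {x..y}" "integral {x..y} (deriv F) = F y - F x"
        and 2: "negligible N2" "\<forall>t. y < t \<longrightarrow> t < z \<longrightarrow> t \<notin> N2 \<longrightarrow> (F has_real_derivative deriv F t) (at t)"
          "deriv F absolutely_integrable_on {y..z}" "integral {y..z} (deriv F) = F z - F y"
        unfolding \<Phi>_def by blast
      have ai: "deriv F absolutely_integrable_on {x..z}"
        using 1(3) 2(3) trans(3,4)
        by (auto simp: absolutely_integrable_on_def intro: Henstock_Kurzweil_Integration.integrable_combine)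
      show "\<Phi> x z" unfolding \<Phi>_def
      proof (intro exI[of _ "N1 \<union> N2 \<union> {y}"] conjI ai)
        show "negligible (N1 \<union> N2 \<union> {y})" using 1(1) 2(1) by (intro negligible_Un) simp_all
        show "\<forall>t. x < t \<longrightarrow> t < z \<longrightarrow> t \<notin> N1 \<union> N2 \<union> {y} \<longrightarrow> (F has_real_derivative deriv F t) (at t)"
          using 1(2) 2(2) by (metis UnCI insertI1 linorder_neqE_linordered_idom)
        show "integral {x..z} (deriv F) = F z - F x"
          using Henstock_Kurzweil_Integration.integral_combine[of x y z "deriv F"] trans(3,4) ai 1(4) 2(4)
          by (simp add: absolutely_integrable_on_def)
      qed
    qed
  next
    case (local x)
    obtain \<delta> where \<delta>: "0 < \<delta>" "\<And>D. D division_of \<Union>D \<Longrightarrow> \<Union>D \<subseteq> {c..d} \<Longrightarrow> (\<Sum>K\<in>D. measure lborel K) < \<delta> \<Longrightarrow>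
        (\<Sum>K\<in>D. \<bar>F (Sup K) - F (Inf K)\<bar>) < 1"
      using abs_continuous_onD[OF F zero_less_one] by blast
    show ?case
    proof (intro exI[of _ \<delta>] conjI allI impI \<delta>(1))
      fix y z assume x: "y \<le> x \<and> x \<le> z \<and> z - y < \<delta>" and yz: "c \<le> y \<and> z \<le> d"
      show "\<Phi> y z"
      proof (cases "y = z")
        case False
        then have lt: "y < z" using x by linarith
        have sub: "{y..z} \<subseteq> {c..d}" using yz by auto
        have AC: "abs_continuous_on {y..z} F" by (rule abs_continuous_on_subset[OF F sub])
        have "\<exists>g. g absolutely_integrable_on {y..z} \<and> (\<forall>t\<in>{y..z}. integral {y..t} g = F t - F y)"
        proof (rule abs_continuous_local_density[OF lt AC])
          fix D assume D: "D division_of \<Union>D" "\<Union>D \<subseteq> {y..z}"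
          have "(\<Sum>K\<in>D. measure lborel K) \<le> measure lborel (cbox y z)"
            using subadditive_content_division[OF D(1)] D(2) by simp
          also have "\<dots> < \<delta>" using x by simp
          finally show "(\<Sum>K\<in>D. \<bar>F (Sup K) - F (Inf K)\<bar>) \<le> 1"
            using \<delta>(2)[OF D(1) subset_trans[OF D(2) sub]] by simp
        qed
        then obtain g where g: "g absolutely_integrable_on {y..z}" "\<forall>t\<in>{y..z}. integral {y..t} g = F t - F y"
          by blast
        obtain N where N: "negligible N"
          "\<And>x. y < x \<Longrightarrow> x < z \<Longrightarrow> x \<notin> N \<Longrightarrow> ((\<lambda>t. integral {y..t} g) has_real_derivative g x) (at x)"
          using integral_has_derivative_ae[of g y z] g(1) unfolding absolutely_integrable_on_def by blast
        have der: "(F has_real_derivative g t) (at t)" if t: "y < t" "t < z" "t \<notin> N" for t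
        proof -
          have "((\<lambda>t. integral {y..t} g + F y) has_real_derivative g t) (at t)"
            using DERIV_add[OF N(2)[OF t] DERIV_const[of "F y"]] by simp
          then show ?thesis
            by (rule has_field_derivative_transform_within_open[of _ _ _ "{y<..<z}"]) (use t g(2) in auto)
        qed
        have eq: "deriv F t = g t" if "t \<in> {y..z} - (N \<union> {y,z})" for t
          using der[of t] that by (intro DERIV_imp_deriv) auto
        have NN: "negligible (N \<union> {y,z})" using N(1) by (intro negligible_Un) simp_all
        show ?thesis unfolding \<Phi>_def
        proof (intro exI[of _ N] conjI allI impI N(1))
          show "(F has_real_derivative deriv F t) (at t)" if "y < t" "t < z" "t \<notin> N" for t
            using der[OF that] DERIV_imp_deriv by metis
          show "deriv F absolutely_integrable_on {y..z}"
            by (rule absolutely_integrable_spike[OF g(1) NN eq])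
          have "integral {y..z} g = integral {y..z} (deriv F)"
            by (rule integral_spike[OF NN eq])
          then show "integral {y..z} (deriv F) = F z - F y" using g(2) lt by simp
        qed
      qed (simp add: trivial)
    qed
  qed
  then show ?thesis unfolding \<Phi>_def by simp
qed

lemma abs_continuous_increment_ge:
  assumes cd: "c \<le> d" and F: "abs_continuous_on {c..d} F" and w: "w integrable_on {c..d}"
    and N: "negligible N"
    and le: "\<And>x. c < x \<Longrightarrow> x < d \<Longrightarrow> x \<notin> N \<Longrightarrow> (F has_real_derivative deriv F x) (at x) \<Longrightarrow> w x \<le> deriv F x"
  shows "integral {c..d} w \<le> F d - F c"
proof -
  obtain N1 where N1: "negligible N1"
    "\<forall>x. c < x \<longrightarrow> x < d \<longrightarrow> x \<notin> N1 \<longrightarrow> (F has_real_derivative deriv F x) (at x)"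
    "deriv F absolutely_integrable_on {c..d}" "integral {c..d} (deriv F) = F d - F c"
    using abs_continuous_FTC[OF cd F] by blast
  define M where "M = N \<union> N1 \<union> {c,d}"
  define w' where "w' x = (if x \<in> M then deriv F x else w x)" for x
  have M: "negligible M" unfolding M_def using N N1(1) by (intro negligible_Un) simp_all
  have w': "w' integrable_on {c..d}"
    by (rule integrable_spike[OF w M]) (simp add: w'_def)
  have "integral {c..d} w = integral {c..d} w'"
    by (rule integral_spike[OF M]) (simp add: w'_def)
  also have "\<dots> \<le> integral {c..d} (deriv F)"
  proof (rule integral_le[OF w'])
    show "deriv F integrable_on {c..d}" using N1(3) by (simp add: absolutely_integrable_on_def)
    fix x assume "x \<in> {c..d}"
    then show "w' x \<le> deriv F x"
      using le[of x] N1(2) by (auto simp: w'_def M_def)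
  qed
  finally show ?thesis using N1(4) by simp
qed

lemma abs_continuous_on_id: "abs_continuous_on S (\<lambda>x. x)"
  unfolding abs_continuous_on_def
proof (intro allI impI exI conjI)
  fix \<epsilon> :: real and D :: "real set set"
  assume D: "D division_of \<Union>D \<and> \<Union>D \<subseteq> S \<and> (\<Sum>K\<in>D. measure lborel K) < \<epsilon>"
  then have Ddiv: "D division_of \<Union>D" by (elim conjE)
  have "(\<Sum>K\<in>D. \<bar>Sup K - Inf K\<bar>) = (\<Sum>K\<in>D. measure lborel K)"
  proof (rule sum.cong)
    fix K assume K: "K \<in> D"
    obtain y z where "K = {y..z}" "y \<le> z"
      using division_ofD(3)[OF Ddiv K] division_ofD(4)[OF Ddiv K] by auto
    then show "\<bar>Sup K - Inf K\<bar> = measure lborel K" by simp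
  qed simp
  then show "(\<Sum>K\<in>D. \<bar>Sup K - Inf K\<bar>) < \<epsilon>" using D by simp
qed

lemma abs_continuous_on_compose_C1:
  fixes F \<phi> :: "real \<Rightarrow> real"
  assumes F: "abs_continuous_on {c..d} F"
    and der: "\<And>t. t \<in> F ` {c..d} \<Longrightarrow> (\<phi> has_real_derivative \<phi>' t) (at t)"
    and cont: "continuous_on (F ` {c..d}) \<phi>'"
  shows "abs_continuous_on {c..d} (\<lambda>x. \<phi> (F x))"
proof -
  have cF: "continuous_on {c..d} F" by (rule abs_continuous_on_imp_continuous_on[OF F])
  have "compact (F ` {c..d})" by (rule compact_continuous_image[OF cF]) simp
  then have "bounded (\<phi>' ` F ` {c..d})"
    by (intro compact_imp_bounded compact_continuous_image[OF cont])
  then obtain B where B: "\<And>t. t \<in> F ` {c..d} \<Longrightarrow> norm (\<phi>' t) \<le> B"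
    unfolding bounded_iff by blast
  have "connected (F ` {c..d})" by (rule connected_continuous_image[OF cF]) simp
  then have conv: "convex (F ` {c..d})"
    by (simp add: is_interval_convex_1[symmetric] is_interval_connected_1)
  show ?thesis
  proof (rule abs_continuous_on_dominated[OF F F, where C = "B"])
    fix y z assume yz: "y \<in> {c..d}" "z \<in> {c..d}"
    have "norm (\<phi> (F z) - \<phi> (F y)) \<le> B * norm (F z - F y)"
      by (rule field_differentiable_bound[OF conv _ B])
        (use yz der in \<open>auto intro: has_field_derivative_at_within\<close>)
    moreover have "0 \<le> B * norm (F z - F y)" using calculation by (rule order_trans[OF norm_ge_zero])
    ultimately show "\<bar>\<phi> (F z) - \<phi> (F y)\<bar> \<le> B * \<bar>F z - F y\<bar> + B * \<bar>F z - F y\<bar>" by simp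
  qed
qed

lemma C1_imp_abs_continuous_on:
  fixes F :: "real \<Rightarrow> real"
  assumes "\<And>t. t \<in> {c..d} \<Longrightarrow> (F has_real_derivative F' t) (at t)" and "continuous_on {c..d} F'"
  shows "abs_continuous_on {c..d} F"
  using abs_continuous_on_compose_C1[OF abs_continuous_on_id, of c d F F'] assms by simp

lemma abs_continuous_on_mult:
  fixes F G :: "real \<Rightarrow> real"
  assumes F: "abs_continuous_on {c..d} F" and G: "abs_continuous_on {c..d} G"
  shows "abs_continuous_on {c..d} (\<lambda>x. F x * G x)"
proof -
  have "bounded (F ` {c..d})" "bounded (G ` {c..d})"
    using F G by (auto intro!: compact_imp_bounded compact_continuous_image abs_continuous_on_imp_continuous_on)
  then obtain B1 B2 where B: "\<And>x. x \<in> {c..d} \<Longrightarrow> \<bar>F x\<bar> \<le> B1" "\<And>x. x \<in> {c..d} \<Longrightarrow> \<bar>G x\<bar> \<le> B2"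
    unfolding bounded_iff by (metis imageI real_norm_def)
  define C where "C = max B1 B2"
  show ?thesis
  proof (rule abs_continuous_on_dominated[OF F G, where C = C])
    fix y z assume yz: "y \<in> {c..d}" "z \<in> {c..d}"
    have "F z * G z - F y * G y = G z * (F z - F y) + F y * (G z - G y)" by (simp add: algebra_simps)
    then have "\<bar>F z * G z - F y * G y\<bar> \<le> \<bar>G z\<bar> * \<bar>F z - F y\<bar> + \<bar>F y\<bar> * \<bar>G z - G y\<bar>"
      by (metis abs_mult abs_triangle_ineq)
    also have "\<dots> \<le> C * \<bar>F z - F y\<bar> + C * \<bar>G z - G y\<bar>"
      using B[OF yz(1)] B[OF yz(2)] by (intro add_mono mult_right_mono) (auto simp: C_def)
    finally show "\<bar>F z * G z - F y * G y\<bar> \<le> C * \<bar>F z - F y\<bar> + C * \<bar>G z - G y\<bar>" .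
  qed
qed

lemma primitive_of_continuous:
  assumes H: "loc_AC_primitive H h" and h: "continuous_on {0<..} h" and s: "0 < s"
  shows "(H has_real_derivative h s) (at s)"
proof -
  define c d where "c = s / 2" and "d = 2 * s"
  have cd: "0 < c" "c < s" "s < d" using s by (auto simp: c_def d_def)
  have AC: "abs_continuous_on {c..d} H"
    using H cd unfolding loc_AC_primitive_def loc_abs_continuous_on_def by (auto simp: subset_iff)
  obtain N where N: "negligible N" "\<And>t. t \<notin> N \<Longrightarrow> 0 < t \<Longrightarrow> (H has_real_derivative h t) (at t)"
    using H unfolding loc_AC_primitive_def eventually_ae_filter_negligible by blast
  have int: "H t = integral {c..t} h + H c" if t: "t \<in> {c..d}" for t
  proof -
    have "abs_continuous_on {c..t} H" by (rule abs_continuous_on_subset[OF AC]) (use t in auto)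
    then have "integral {c..t} (deriv H) = H t - H c"
      using abs_continuous_FTC[of c t H] t by auto
    moreover have "integral {c..t} (deriv H) = integral {c..t} h"
    proof (rule integral_spike[OF N(1)])
      fix x assume "x \<in> {c..t} - N"
      then have "(H has_real_derivative h x) (at x)" using N(2)[of x] cd by simp
      then show "h x = deriv H x" by (simp add: DERIV_imp_deriv)
    qed
    ultimately show ?thesis by simp
  qed
  have "{c..d} \<subseteq> {0<..}" using cd(1) by auto
  with h have "continuous_on {c..d} h" by (rule continuous_on_subset)
  then have "((\<lambda>t. integral {c..t} h) has_real_derivative h s) (at s within {c..d})"
    by (rule integral_has_real_derivative) (use cd in auto)
  moreover have "at s within {c..d} = at s" by (rule at_within_interior) (use cd in simp)
  ultimately have "((\<lambda>t. integral {c..t} h + H c) has_real_derivative h s) (at s)"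
    by (auto intro!: derivative_eq_intros)
  then show ?thesis
    by (rule has_field_derivative_transform_within_open[of _ _ _ "{c<..<d}"]) (use cd int[symmetric] in simp_all)
qed

section \<open>Signed powers and Young's inequality\<close>

text \<open>The map \<open>t \<mapsto> |t|^(p-2) t\<close> is continuously differentiable, also at \<open>0\<close>. The case distinction is needed
  since \<open>0 powr 0 = 0\<close>.\<close>

lemma signed_power_has_derivative:
  fixes p t :: real
  assumes p: "2 \<le> p"
  shows "((\<lambda>t. \<bar>t\<bar> powr (p - 2) * t) has_real_derivative (p - 1) * (if p = 2 then 1 else \<bar>t\<bar> powr (p - 2))) (at t)"
proof (cases "t = 0")
  case False
  show ?thesis
  proof (cases "0 < t")
    case True
    have "((\<lambda>t. t powr (p - 2) * t) has_real_derivative (p - 1) * t powr (p - 2)) (at t)"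
      by (auto intro!: derivative_eq_intros True) (use True in \<open>simp add: powr_diff field_simps eval_nat_numeral\<close>)
    then show ?thesis
      by (rule has_field_derivative_transform_within_open[of _ _ _ "{0<..}", THEN DERIV_cong]) (use True in auto)
  next
    case neg: False
    then have t: "t < 0" using False by simp
    have "((\<lambda>t. (- t) powr (p - 2) * t) has_real_derivative (p - 1) * (- t) powr (p - 2)) (at t)"
      by (auto intro!: derivative_eq_intros simp: t) (use t in \<open>simp add: powr_diff field_simps eval_nat_numeral\<close>)
    then show ?thesis
      by (rule has_field_derivative_transform_within_open[of _ _ _ "{..<0}", THEN DERIV_cong]) (use t in auto)
  qed
next
  case True
  show ?thesis
  proof (cases "p = 2")
    case p2: True
    have "(\<lambda>t::real. \<bar>t\<bar> powr (p - 2) * t) = (\<lambda>t. t)" by (auto simp: p2)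
    then show ?thesis by (simp add: p2)
  next
    case False
    have "continuous_on UNIV (\<lambda>t::real. \<bar>t\<bar> powr (p - 2))"
      by (intro continuous_on_powr' continuous_intros) (use False p in auto)
    then have "(\<lambda>t::real. \<bar>t\<bar> powr (p - 2)) \<midarrow>0\<rightarrow> \<bar>0\<bar> powr (p - 2)"
      by (metis UNIV_I continuous_on_def open_UNIV at_within_open)
    then have "(\<lambda>t::real. \<bar>t\<bar> powr (p - 2)) \<midarrow>0\<rightarrow> 0" by simp
    then have "(\<lambda>y::real. (\<bar>y\<bar> powr (p - 2) * y - \<bar>0\<bar> powr (p - 2) * 0) / (y - 0)) \<midarrow>0\<rightarrow> 0"
      by (rule Lim_transform_eventually) (auto simp: eventually_at_filter)
    then show ?thesis using True False by (simp add: has_field_derivative_iff)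
  qed
qed

lemma signed_power_derivative_continuous:
  fixes p :: real
  assumes "2 \<le> p"
  shows "continuous_on UNIV (\<lambda>t::real. (p - 1) * (if p = 2 then 1 else \<bar>t\<bar> powr (p - 2)))"
  by (cases "p = 2") (use assms in \<open>auto intro!: continuous_intros continuous_on_powr'\<close>)

text \<open>The form of Young's inequality that produces the constant \<open>K\<close>: the weight \<open>1 - 2/p\<close> leaves the same
  factor \<open>2/p\<close> in front of both integrands in \<open>increment_on_positive_interval\<close>.\<close>

lemma young_flux:
  fixes p v m L k :: real
  assumes p: "2 \<le> p" and v: "0 \<le> v" and m: "0 \<le> m" and L: "0 \<le> L" and k: "0 < k"
  shows "(p - 1) * (if p = 2 then 1 else v powr (p - 2)) * m * L
    \<le> (1 - 2 / p) * (v powr p * k) + 2 / p * ((p - 1) powr (p / 2) * ((m * (L / k)) powr (p / 2) * k))"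
proof (cases "p = 2")
  case True
  then show ?thesis using m L k by simp
next
  case False
  then have p2: "2 < p" using p by simp
  show ?thesis
  proof (cases "v = 0 \<or> m * L = 0")
    case True
    have "(p - 1) * (if p = 2 then 1 else v powr (p - 2)) * m * L = 0" using True False by auto
    also have "\<dots> \<le> (1 - 2 / p) * (v powr p * k) + 2 / p * ((p - 1) powr (p / 2) * ((m * (L / k)) powr (p / 2) * k))"
      using p2 k by (intro add_nonneg_nonneg mult_nonneg_nonneg) auto
    finally show ?thesis .
  next
    case nz: False
    then have pos: "0 < v" "0 < m * (L / k)" using v m L k
      by (auto simp: less_le)
    define A where "A = (p - 1) powr (p / 2) * ((m * (L / k)) powr (p / 2) * k)"
    define B where "B = v powr p * k"
    have "m * (L / k) \<noteq> 0" using pos(2) by linarith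
    then have A: "0 < A" unfolding A_def
      using p2 k by (intro mult_pos_pos) (auto simp only: powr_gt_zero)
    have AB: "0 < A" "0 < B" using A pos k by (simp_all add: B_def)
    have "A powr (2 / p) = (p - 1) * (m * (L / k)) * k powr (2 / p)"
      unfolding A_def using pos p2 k mult_nonneg_nonneg[OF m L] by (simp add: powr_mult powr_powr)
    moreover have "B powr (1 - 2 / p) = v powr (p - 2) * k powr (1 - 2 / p)"
      unfolding B_def using pos p2 k by (simp add: powr_mult powr_powr algebra_simps)
    ultimately have "A powr (2 / p) * B powr (1 - 2 / p)
        = (p - 1) * (m * (L / k)) * v powr (p - 2) * (k powr (2 / p) * k powr (1 - 2 / p))" by simp
    also have "k powr (2 / p) * k powr (1 - 2 / p) = k"
      using k by (simp add: powr_add[symmetric])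
    also have "(p - 1) * (m * (L / k)) * v powr (p - 2) * k = (p - 1) * v powr (p - 2) * m * L"
      using k by simp
    finally show ?thesis
      using Youngs_inequality_0[of "2 / p" "1 - 2 / p" A B] AB p2 False
      by (simp add: A_def B_def algebra_simps)
  qed
qed

text \<open>Young's inequality for the pointwise Hardy estimate. The powers of \<open>l\<close> are chosen so that, for \<open>l = - H(f)\<close>,
  the second summand is an exact derivative, and the parameter \<open>\<nu>\<close> may be made small. For \<open>p = 2\<close> the second
  summand vanishes.\<close>

lemma young_hardy:
  fixes p v m l k \<mu> \<nu> :: real
  assumes p: "2 \<le> p" and v: "0 < v" and m: "0 \<le> m" and l: "0 < l" and k: "0 < k"
    and \<mu>: "0 < \<mu>" and \<nu>: "0 < \<nu>" and \<mu>\<nu>: "\<mu> powr (2 / p) * \<nu> powr (1 - 2 / p) = 1"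
  shows "v powr (1 - 2 / p) * m
    \<le> 2 / p * \<mu> * l powr (- 2 / p) * ((m * (l / k)) powr (p / 2) * k)
      + (1 - 2 / p) * \<nu> * l powr (- 1 - 2 / p) * (k * v)"
proof (cases "m = 0")
  case True
  then show ?thesis using assms by (simp add: field_simps)
next
  case False
  then have m: "0 < m" using m by simp
  define A where "A = \<mu> * l powr (- 2 / p) * ((m * (l / k)) powr (p / 2) * k)"
  define B where "B = \<nu> * l powr (- 1 - 2 / p) * (k * v)"
  have AB: "0 < A" "0 < B" using assms m by (simp_all add: A_def B_def)
  have A': "A powr (2 / p) = \<mu> powr (2 / p) * l powr (- 2 / p * (2 / p)) * (m * (l / k)) * k powr (2 / p)"
    unfolding A_def using assms m by (simp add: powr_mult powr_powr)
  have B': "B powr (1 - 2 / p) = \<nu> powr (1 - 2 / p) * l powr ((- 1 - 2 / p) * (1 - 2 / p)) * k powr (1 - 2 / p) * v powr (1 - 2 / p)"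
    unfolding B_def using assms m by (simp add: powr_mult powr_powr)
  have "A powr (2 / p) * B powr (1 - 2 / p) = (\<mu> powr (2 / p) * \<nu> powr (1 - 2 / p)) *
      (l powr (- 2 / p * (2 / p)) * l powr ((- 1 - 2 / p) * (1 - 2 / p))) *
      (k powr (2 / p) * k powr (1 - 2 / p)) * (m * (l / k)) * v powr (1 - 2 / p)"
    unfolding A' B' by (simp only: mult_ac)
  also have "l powr (- 2 / p * (2 / p)) * l powr ((- 1 - 2 / p) * (1 - 2 / p)) = l powr (- 1)"
    unfolding powr_add[symmetric] by (rule arg_cong[where f = "(powr) l"]) (use p in \<open>simp add: field_simps\<close>)
  also have "k powr (2 / p) * k powr (1 - 2 / p) = k"
    using k by (simp add: powr_add[symmetric])
  finally have "A powr (2 / p) * B powr (1 - 2 / p) = v powr (1 - 2 / p) * m"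
    using l k \<mu>\<nu> by (simp add: powr_minus field_simps)
  then show ?thesis
    using Youngs_inequality_0[of "2 / p" "1 - 2 / p" A B] AB p
    by (simp add: A_def B_def algebra_simps)
qed

section \<open>The basic inequality where the function is positive\<close>

text \<open>The standing assumptions, with \<open>H\<close> a classical primitive of \<open>h\<close> on \<open>(0,\<infinity>)\<close> and \<open>f\<close> a nonnegative element
  of \<open>W21_loc a b\<close>; the boundary condition is not included.\<close>

locale half_line_weight =
  fixes p :: real and a b :: ereal and h H f :: "real \<Rightarrow> real"
  assumes p: "2 \<le> p"
    and h_cont: "continuous_on {0<..} h"
    and h_pos: "\<And>s. 0 < s \<Longrightarrow> 0 < h s"
    and H_deriv: "\<And>s. 0 < s \<Longrightarrow> (H has_real_derivative h s) (at s)"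
    and f_diff: "\<And>x. x \<in> einterval a b \<Longrightarrow> f differentiable (at x)"
    and f'_AC: "loc_abs_continuous_on (einterval a b) (deriv f)"
    and f_nonneg: "\<And>x. x \<in> einterval a b \<Longrightarrow> 0 \<le> f x"
begin

text \<open>The integrand of the left-hand side; it is only used where \<open>f\<close> is positive.\<close>

definition energy :: "real \<Rightarrow> real" where
  "energy x = \<bar>deriv f x\<bar> powr p * h (f x)"

text \<open>The integrand of the right-hand side, extended by \<open>0\<close> outside \<open>{x \<in> (a,b). f x > 0}\<close>.\<close>

definition source :: "real \<Rightarrow> real" where
  "source x = (if x \<in> einterval a b \<and> 0 < f x
     then \<bar>deriv (deriv f) x * T_transform H h (f x)\<bar> powr (p / 2) * h (f x) else 0)"

text \<open>The constant of the inequality, equal to \<open>sqrt (p - 1) powr p\<close>.\<close>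

definition K :: real where "K = (p - 1) powr (p / 2)"

lemma source_nonneg: "0 \<le> source x"
  by (auto simp: source_def intro!: mult_nonneg_nonneg less_imp_le[OF h_pos])

lemma K_pos: "0 < K" using p by (simp add: K_def)

lemma f_deriv: "x \<in> einterval a b \<Longrightarrow> (f has_real_derivative deriv f x) (at x)"
  using f_diff DERIV_deriv_iff_real_differentiable by blast

lemma f'_AC_on: "{y..z} \<subseteq> einterval a b \<Longrightarrow> abs_continuous_on {y..z} (deriv f)"
  using f'_AC unfolding loc_abs_continuous_on_def by blast

lemma H_cont: "continuous_on {0<..} H"
  by (rule DERIV_continuous_on) (auto intro: has_field_derivative_at_within H_deriv)

lemma H_mono:
  assumes "0 < s" "s \<le> t"
  shows "H s \<le> H t"
proof (rule DERIV_nonneg_imp_nondecreasing[OF assms(2)])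
  fix r assume "s \<le> r"
  with assms(1) have "0 < r" by simp
  then show "\<exists>y. (H has_real_derivative y) (at r) \<and> 0 \<le> y"
    using H_deriv h_pos less_imp_le by blast
qed

lemma boundary_term_pos: "0 < f x \<Longrightarrow> boundary_term p H f x = \<bar>deriv f x\<bar> powr (p - 2) * deriv f x * H (f x)"
  by (simp add: boundary_term_def zero_extension_def)

lemma boundary_term_zero: "f x = 0 \<Longrightarrow> boundary_term p H f x = 0"
  by (simp add: boundary_term_def zero_extension_def)

lemma abs_powr_times_square: "\<bar>t\<bar> powr (p - 2) * t * t = \<bar>t\<bar> powr p"
proof (cases "t = 0")
  case False
  have "\<bar>t\<bar> powr p = \<bar>t\<bar> powr ((p - 2) + 2)" by simp
  also have "\<dots> = \<bar>t\<bar> powr (p - 2) * \<bar>t\<bar> powr 2" by (rule powr_add)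
  also have "\<bar>t\<bar> powr 2 = t * t" using False by (simp add: power2_eq_square[symmetric])
  finally show ?thesis by (simp add: mult.assoc)
qed simp

text \<open>The basic inequality \<open>G' \<ge> (2/p) (energy - K source)\<close>, integrated over an interval on which \<open>f\<close> is
  positive. The minorant \<open>w\<close> is left free, to allow cut-off energies.\<close>

lemma increment_on_positive_interval:
  assumes yz: "y \<le> z" and sub: "{y..z} \<subseteq> einterval a b" and pos: "\<And>x. x \<in> {y..z} \<Longrightarrow> 0 < f x"
    and w: "w integrable_on {y..z}" and le: "\<And>x. x \<in> {y..z} \<Longrightarrow> w x \<le> energy x - K * source x"
  shows "2 / p * integral {y..z} w \<le> boundary_term p H f z - boundary_term p H f y"
proof -
  define F where "F x = \<bar>deriv f x\<bar> powr (p - 2) * deriv f x * H (f x)" for x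
  have AC': "abs_continuous_on {y..z} (deriv f)" by (rule f'_AC_on[OF sub])
  have img: "f ` {y..z} \<subseteq> {0<..}" using pos by auto
  have "abs_continuous_on {y..z} f"
    by (rule C1_imp_abs_continuous_on[OF f_deriv abs_continuous_on_imp_continuous_on[OF AC']])
      (use sub in auto)
  then have "abs_continuous_on {y..z} (\<lambda>x. H (f x))"
    by (rule abs_continuous_on_compose_C1) (use pos H_deriv continuous_on_subset[OF h_cont img] in auto)
  moreover have "abs_continuous_on {y..z} (\<lambda>x. \<bar>deriv f x\<bar> powr (p - 2) * deriv f x)"
    by (rule abs_continuous_on_compose_C1[OF AC' signed_power_has_derivative[OF p]
          continuous_on_subset[OF signed_power_derivative_continuous[OF p]]]) simp
  ultimately have F: "abs_continuous_on {y..z} F"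
    unfolding F_def using abs_continuous_on_mult by blast
  obtain N where N: "negligible N"
    "\<And>x. y < x \<Longrightarrow> x < z \<Longrightarrow> x \<notin> N \<Longrightarrow> (deriv f has_real_derivative deriv (deriv f) x) (at x)"
    using abs_continuous_FTC[OF yz AC'] by blast
  have "integral {y..z} (\<lambda>x. 2 / p * w x) \<le> F z - F y"
  proof (rule abs_continuous_increment_ge[OF yz F _ N(1)])
    show "(\<lambda>x. 2 / p * w x) integrable_on {y..z}" using w by (rule integrable_on_mult_right)
    fix x assume x: "y < x" "x < z" "x \<notin> N" "(F has_real_derivative deriv F x) (at x)"
    then have xin: "x \<in> {y..z}" by simp
    then have fx: "0 < f x" and xab: "x \<in> einterval a b" using pos sub by auto
    define t where "t = deriv f x"
    define m where "m = deriv (deriv f) x"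
    define c where "c = (p - 1) * (if p = 2 then 1 else \<bar>t\<bar> powr (p - 2))"
    have "(F has_real_derivative c * m * H (f x) + h (f x) * t * (\<bar>t\<bar> powr (p - 2) * t)) (at x)"
      unfolding F_def t_def c_def m_def
      by (rule DERIV_mult[OF DERIV_chain2[OF signed_power_has_derivative[OF p] N(2)[OF x(1-3)]]
            DERIV_chain2[OF H_deriv[OF fx] f_deriv[OF xab]]])
    then have dF: "deriv F x = c * m * H (f x) + energy x"
      unfolding energy_def t_def[symmetric] abs_powr_times_square[of t, symmetric]
      by (auto dest!: DERIV_imp_deriv simp: mult_ac)
    have "- (c * m * H (f x)) \<le> \<bar>c * m * H (f x)\<bar>" by simp
    also have "\<dots> = c * \<bar>m\<bar> * \<bar>H (f x)\<bar>" using p by (simp add: abs_mult c_def)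
    also have "\<dots> \<le> (1 - 2 / p) * (\<bar>t\<bar> powr p * h (f x)) +
        2 / p * ((p - 1) powr (p / 2) * ((\<bar>m\<bar> * (\<bar>H (f x)\<bar> / h (f x))) powr (p / 2) * h (f x)))"
      unfolding c_def by (rule young_flux[OF p]) (use h_pos[OF fx] in auto)
    also have "\<bar>m\<bar> * (\<bar>H (f x)\<bar> / h (f x)) = \<bar>m * T_transform H h (f x)\<bar>"
      using h_pos[OF fx] by (simp add: T_transform_def abs_mult)
    also have "(1 - 2 / p) * (\<bar>t\<bar> powr p * h (f x)) +
        2 / p * ((p - 1) powr (p / 2) * (\<bar>m * T_transform H h (f x)\<bar> powr (p / 2) * h (f x)))
        = (1 - 2 / p) * energy x + 2 / p * (K * source x)"
      using fx xab by (simp add: energy_def source_def K_def t_def m_def)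
    finally have "2 / p * (energy x - K * source x) \<le> deriv F x"
      unfolding dF by (simp add: algebra_simps)
    moreover have "2 / p * w x \<le> 2 / p * (energy x - K * source x)"
      using le[OF xin] p by (intro mult_left_mono) auto
    ultimately show "2 / p * w x \<le> deriv F x" by linarith
  qed
  moreover have "F z = boundary_term p H f z" "F y = boundary_term p H f y"
    using pos[of y] pos[of z] yz by (simp_all add: F_def boundary_term_pos)
  ultimately show ?thesis by simp
qed

end

text \<open>The right-hand side is finite; otherwise there is nothing to prove.\<close>

locale half_line_weight_finite = half_line_weight +
  assumes source_integrable: "source integrable_on UNIV"
begin

lemma source_integrable_on: "source integrable_on {y..z}"
  by (rule integrable_on_subinterval[OF source_integrable]) simp

text \<open>Pointwise Hardy estimate near a zero of \<open>f\<close>, where \<open>f\<close> is strictly monotone and \<open>H(f) < 0\<close>. The sign \<open>\<sigma>\<close>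
  is \<open>1\<close> if \<open>f\<close> decreases (approach to the zero from the left) and \<open>- 1\<close> if it increases. In terms of
  \<open>v = |f'|\<close> and \<open>l = - H(f)\<close>, the correction \<open>l^(-2/p)\<close> in \<open>Q\<close> absorbs the second summand of \<open>young_hardy\<close>.\<close>

lemma hardy_segment:
  fixes \<sigma> \<mu> \<nu> l0 s t :: real
  defines "C \<equiv> 2 * (p - 1) / p"
  defines "Q \<equiv> \<lambda>x. \<bar>deriv f x\<bar> powr C - C * (1 - 2 / p) * \<nu> * (p / 2) * (- H (f x)) powr (- 2 / p)"
  assumes st: "s \<le> t" and sub: "{s..t} \<subseteq> einterval a b" and \<sigma>: "\<sigma> = 1 \<or> \<sigma> = - 1"
    and \<mu>: "0 < \<mu>" and \<nu>: "0 < \<nu>" and \<mu>\<nu>: "\<mu> powr (2 / p) * \<nu> powr (1 - 2 / p) = 1"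
    and pos: "\<And>x. x \<in> {s..t} \<Longrightarrow> 0 < f x" and neg: "\<And>x. x \<in> {s..t} \<Longrightarrow> \<sigma> * deriv f x < 0"
    and l0: "0 < l0" "\<And>x. x \<in> {s..t} \<Longrightarrow> l0 \<le> - H (f x)"
  shows "- (C * (2 / p) * \<mu> * l0 powr (- 2 / p)) * integral {s..t} source \<le> \<sigma> * (Q t - Q s)"
proof -
  define F where "F x = \<sigma> * ((- \<sigma> * deriv f x) powr C)
      - \<sigma> * C * (1 - 2 / p) * \<nu> * (p / 2) * (- H (f x)) powr (- 2 / p)" for x
  have C: "0 < C" "C - 1 = 1 - 2 / p" using p by (simp_all add: C_def field_simps)
  have AC': "abs_continuous_on {s..t} (deriv f)" by (rule f'_AC_on[OF sub])
  have img: "f ` {s..t} \<subseteq> {0<..}" using pos by auto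
  have imgH: "- H r > 0" if "r \<in> f ` {s..t}" for r using l0 that by force
  have AC0: "abs_continuous_on {s..t} f"
    by (rule C1_imp_abs_continuous_on[OF f_deriv abs_continuous_on_imp_continuous_on[OF AC']])
      (use sub in auto)
  define c where "c = C * (1 - 2 / p) * \<nu>"
  have d1: "((\<lambda>r. \<sigma> * ((- \<sigma> * r) powr C)) has_real_derivative - (C * (- \<sigma> * r) powr (1 - 2 / p))) (at r)"
    if "- \<sigma> * r > 0" for r
  proof -
    have "((\<lambda>r. \<sigma> * ((- \<sigma> * r) powr C)) has_real_derivative \<sigma> * (C * (- \<sigma> * r) powr (C - 1) * (- \<sigma>))) (at r)"
      by (intro DERIV_cmult DERIV_chain2[where f = "\<lambda>z. z powr C" and g = "\<lambda>r. - \<sigma> * r", OF has_real_derivative_powr[OF that]])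
        (auto intro!: derivative_eq_intros)
    moreover have "\<sigma> * (C * (- \<sigma> * r) powr (C - 1) * (- \<sigma>)) = - (C * (- \<sigma> * r) powr (1 - 2 / p))"
      using \<sigma> C(2) by auto
    ultimately show ?thesis by (rule DERIV_cong)
  qed
  have d2: "((\<lambda>r. \<sigma> * C * (1 - 2 / p) * \<nu> * (p / 2) * (- H r) powr (- 2 / p)) has_real_derivative
      \<sigma> * c * ((- H r) powr (- 1 - 2 / p) * h r)) (at r)" if "0 < r" "- H r > 0" for r
  proof -
    have "((\<lambda>r. \<sigma> * C * (1 - 2 / p) * \<nu> * (p / 2) * (- H r) powr (- 2 / p)) has_real_derivative
      \<sigma> * C * (1 - 2 / p) * \<nu> * (p / 2) * ((- 2 / p) * (- H r) powr (- 2 / p - 1) * (- h r))) (at r)"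
      by (intro DERIV_cmult DERIV_chain2[where f = "\<lambda>z. z powr (- 2 / p)" and g = "\<lambda>r. - H r",
            OF has_real_derivative_powr[OF that(2)]] DERIV_minus H_deriv that(1))
    moreover have "\<sigma> * C * (1 - 2 / p) * \<nu> * (p / 2) * ((- 2 / p) * (- H r) powr (- 2 / p - 1) * (- h r))
        = \<sigma> * c * ((- H r) powr (- 1 - 2 / p) * h r)"
    proof -
      have "- 2 / p - 1 = - 1 - 2 / p" by simp
      moreover have "p / 2 * ((- 2 / p) * X * (- Y)) = X * Y" for X Y using p by simp
      ultimately show ?thesis unfolding c_def by (simp only: mult.assoc)
    qed
    ultimately show ?thesis by (rule DERIV_cong)
  qed
  have F: "abs_continuous_on {s..t} F"
    unfolding F_def
  proof (rule abs_continuous_on_diff)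
    show "abs_continuous_on {s..t} (\<lambda>x. \<sigma> * ((- \<sigma> * deriv f x) powr C))"
    proof (rule abs_continuous_on_compose_C1[OF AC'])
      show "((\<lambda>r. \<sigma> * ((- \<sigma> * r) powr C)) has_real_derivative - (C * (- \<sigma> * r) powr (1 - 2 / p))) (at r)"
        if "r \<in> deriv f ` {s..t}" for r using d1[of r] neg that by auto
      show "continuous_on (deriv f ` {s..t}) (\<lambda>r. - (C * (- \<sigma> * r) powr (1 - 2 / p)))"
        by (intro continuous_intros) (use neg in force)
    qed
    show "abs_continuous_on {s..t} (\<lambda>x. \<sigma> * C * (1 - 2 / p) * \<nu> * (p / 2) * (- H (f x)) powr (- 2 / p))"
    proof (rule abs_continuous_on_compose_C1[OF AC0])
      show "((\<lambda>r. \<sigma> * C * (1 - 2 / p) * \<nu> * (p / 2) * (- H r) powr (- 2 / p)) has_real_derivative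
          \<sigma> * c * ((- H r) powr (- 1 - 2 / p) * h r)) (at r)" if "r \<in> f ` {s..t}" for r
        using d2[of r] imgH[OF that] img that by auto
      show "continuous_on (f ` {s..t}) (\<lambda>r. \<sigma> * c * ((- H r) powr (- 1 - 2 / p) * h r))"
        by (intro continuous_intros continuous_on_subset[OF H_cont img] continuous_on_subset[OF h_cont img])
          (use imgH in force)
    qed
  qed
  obtain N where N: "negligible N"
    "\<And>x. s < x \<Longrightarrow> x < t \<Longrightarrow> x \<notin> N \<Longrightarrow> (deriv f has_real_derivative deriv (deriv f) x) (at x)"
    using abs_continuous_FTC[OF st AC'] by blast
  have "integral {s..t} (\<lambda>x. - (C * (2 / p) * \<mu> * l0 powr (- 2 / p)) * source x) \<le> F t - F s"
  proof (rule abs_continuous_increment_ge[OF st F _ N(1)])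
    show "(\<lambda>x. - (C * (2 / p) * \<mu> * l0 powr (- 2 / p)) * source x) integrable_on {s..t}"
      using source_integrable_on by (rule integrable_on_mult_right)
    fix x assume x: "s < x" "x < t" "x \<notin> N" "(F has_real_derivative deriv F x) (at x)"
    then have xin: "x \<in> {s..t}" by simp
    then have fx: "0 < f x" and xab: "x \<in> einterval a b" and Hx: "0 < - H (f x)" and v: "0 < - \<sigma> * deriv f x"
      using pos sub l0 neg[OF xin] by force+
    define m v l k where "m = deriv (deriv f) x" and "v = - \<sigma> * deriv f x"
      and "l = - H (f x)" and "k = h (f x)"
    have "0 < k" using h_pos[OF fx] by (simp add: k_def)
    have "(F has_real_derivative - (C * v powr (1 - 2 / p)) * m
        - \<sigma> * c * (l powr (- 1 - 2 / p) * k) * deriv f x) (at x)"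
      unfolding F_def m_def v_def l_def k_def
      by (rule DERIV_diff[OF DERIV_chain2[OF d1[OF v] N(2)[OF x(1-3)]] DERIV_chain2[OF d2[OF fx Hx] f_deriv[OF xab]]])
    then have dF: "deriv F x = - (C * (v powr (1 - 2 / p) * m)) + C * ((1 - 2 / p) * \<nu> * l powr (- 1 - 2 / p) * (k * v))"
      unfolding c_def v_def by (auto dest!: DERIV_imp_deriv simp: algebra_simps)
    have "v powr (1 - 2 / p) * m \<le> v powr (1 - 2 / p) * \<bar>m\<bar>" by (intro mult_left_mono) auto
    also have "\<dots> \<le> 2 / p * \<mu> * l powr (- 2 / p) * ((\<bar>m\<bar> * (l / k)) powr (p / 2) * k)
        + (1 - 2 / p) * \<nu> * l powr (- 1 - 2 / p) * (k * v)"
      by (rule young_hardy[OF p _ _ _ _ \<mu> \<nu> \<mu>\<nu>]) (use v Hx \<open>0 < k\<close> in \<open>auto simp: v_def l_def\<close>)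
    also have "(\<bar>m\<bar> * (l / k)) powr (p / 2) * k = source x"
      using fx xab Hx \<open>0 < k\<close> by (simp add: source_def T_transform_def abs_mult m_def l_def k_def)
    finally have 1: "C * (v powr (1 - 2 / p) * m) \<le> C * (2 / p * \<mu> * l powr (- 2 / p) * source x
        + (1 - 2 / p) * \<nu> * l powr (- 1 - 2 / p) * (k * v))"
      using C(1) by (intro mult_left_mono) auto
    have "l powr (- 2 / p) \<le> l0 powr (- 2 / p)"
      using l0(1) l0(2)[OF xin] p by (intro powr_mono2') (auto simp: l_def)
    then have "C * (2 / p) * \<mu> * l powr (- 2 / p) * source x \<le> C * (2 / p) * \<mu> * l0 powr (- 2 / p) * source x"
      using C(1) p \<mu> source_nonneg by (intro mult_right_mono mult_left_mono) auto
    with 1 show "- (C * (2 / p) * \<mu> * l0 powr (- 2 / p)) * source x \<le> deriv F x"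
      unfolding dF by (simp add: algebra_simps)
  qed
  moreover have "F x = \<sigma> * Q x" if "x \<in> {s..t}" for x
  proof -
    have "\<bar>deriv f x\<bar> = - \<sigma> * deriv f x" using neg[OF that] \<sigma> by auto
    then show ?thesis by (simp add: F_def Q_def algebra_simps)
  qed
  ultimately show ?thesis using st by (simp add: algebra_simps)
qed

end

section \<open>Behaviour at interior zeros\<close>

context half_line_weight_finite
begin

lemma source_small:
  assumes "0 < \<epsilon>"
  shows "\<exists>\<delta>>0. \<forall>y z. c \<le> y \<longrightarrow> y \<le> z \<longrightarrow> z \<le> d \<longrightarrow> z - y < \<delta> \<longrightarrow> integral {y..z} source < \<epsilon>"
proof -
  have "(\<lambda>x. \<bar>source x\<bar>) integrable_on {c..d}"
    using source_integrable_on[of c d] source_nonneg by simp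
  then have "source absolutely_integrable_on {c..d}"
    using source_integrable_on[of c d] by (simp add: absolutely_integrable_on_def)
  from abs_continuous_on_lt[OF abs_continuous_on_integral[OF this] assms]
  obtain \<delta> where \<delta>: "0 < \<delta>" "\<forall>y z. y \<le> z \<longrightarrow> {y..z} \<subseteq> {c..d} \<longrightarrow> z - y < \<delta> \<longrightarrow>
      \<bar>integral {c..z} source - integral {c..y} source\<bar> < \<epsilon>" by blast
  show ?thesis
  proof (intro exI[of _ \<delta>] conjI allI impI \<delta>(1))
    fix y z assume yz: "c \<le> y" "y \<le> z" "z \<le> d" "z - y < \<delta>"
    then have "\<bar>integral {c..z} source - integral {c..y} source\<bar> < \<epsilon>" using \<delta>(2) by simp
    moreover have "integral {c..y} source + integral {y..z} source = integral {c..z} source"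
      by (rule Henstock_Kurzweil_Integration.integral_combine[OF yz(1,2) source_integrable_on])
    ultimately show "integral {y..z} source < \<epsilon>" by linarith
  qed
qed

text \<open>On the positive side of a zero \<open>z\<close> of \<open>f\<close>, the boundary term has the sign that allows gluing at \<open>z\<close>, up to
  arbitrarily small errors. One-sided neighbourhoods of \<open>z\<close> are written as \<open>0 < \<sigma> (z - x) < e\<close>: on the left
  for \<open>\<sigma> = 1\<close>, on the right for \<open>\<sigma> = - 1\<close>. If the claim fails, then \<open>v^(p-1) l\<close> with \<open>v = |f'|\<close> and \<open>l = - H(f)\<close>
  is bounded below by \<open>\<eta>\<close> near \<open>z\<close>, which forces \<open>l \<longrightarrow> \<infinity>\<close> because \<open>v \<longrightarrow> 0\<close>; integrating \<open>hardy_segment\<close> up to \<open>z\<close>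
  bounds \<open>v^(2(p-1)/p) l^(2/p)\<close> by half of \<open>\<eta>^(2/p)\<close>.\<close>

lemma boundary_term_small_near_zero:
  fixes \<sigma> \<eta> e0 z :: real
  assumes z: "z \<in> einterval a b" "f z = 0" and \<sigma>: "\<sigma> = 1 \<or> \<sigma> = - 1" and \<eta>: "0 < \<eta>" and e0: "0 < e0"
    and pos0: "\<And>x. 0 < \<sigma> * (z - x) \<Longrightarrow> \<sigma> * (z - x) < e0 \<Longrightarrow> x \<in> einterval a b \<and> 0 < f x"
  shows "\<exists>x. 0 < \<sigma> * (z - x) \<and> \<sigma> * (z - x) < e0 \<and> \<sigma> * boundary_term p H f x < \<eta>"
proof (rule ccontr)
  assume "\<not> ?thesis"
  then have large: "\<eta> \<le> \<sigma> * boundary_term p H f x" if "0 < \<sigma> * (z - x)" "\<sigma> * (z - x) < e0" for x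
    using that by force
  define nF where "nF = at z within {x. 0 < \<sigma> * (z - x)}"
  have nF_iff: "eventually P nF \<longleftrightarrow> (\<exists>e>0. \<forall>x. 0 < \<sigma> * (z - x) \<longrightarrow> \<sigma> * (z - x) < e \<longrightarrow> P x)" for P
  proof -
    have "dist x z = \<sigma> * (z - x)" if "0 < \<sigma> * (z - x)" for x
      using that \<sigma> by (auto simp: dist_real_def)
    then show ?thesis unfolding nF_def eventually_at by fastforce
  qed
  have nF_bot: "nF \<noteq> bot"
  proof
    assume "nF = bot"
    then have "eventually (\<lambda>x. False) nF" by simp
    then obtain e where e: "0 < e" "\<And>x. 0 < \<sigma> * (z - x) \<Longrightarrow> \<not> \<sigma> * (z - x) < e" unfolding nF_iff by blast
    define x where "x = z - \<sigma> * (e / 2)"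
    have "\<sigma> * (z - x) = e / 2" using \<sigma> by (auto simp: x_def)
    with e(1) e(2)[of x] show False by linarith
  qed
  have nF_le: "nF \<le> at z" unfolding nF_def by (rule at_le) simp
  have ev0: "\<forall>\<^sub>F x in nF. x \<in> einterval a b \<and> 0 < f x \<and> \<eta> \<le> \<sigma> * boundary_term p H f x"
    unfolding nF_iff using e0 pos0 large by blast
  obtain r where r: "0 < r" "{z - r..z + r} \<subseteq> einterval a b"
  proof -
    obtain e where "0 < e" "ball z e \<subseteq> einterval a b"
      using open_einterval z(1) open_contains_ball by metis
    then have "{z - e / 2..z + e / 2} \<subseteq> einterval a b" by (auto simp: ball_def dist_real_def subset_iff abs_if)
    with \<open>0 < e\<close> show thesis using that[of "e / 2"] by simp
  qed
  have f'_lim: "(deriv f \<longlongrightarrow> deriv f z) nF"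
  proof -
    have "continuous_on {z - r..z + r} (deriv f)"
      by (rule abs_continuous_on_imp_continuous_on[OF f'_AC_on[OF r(2)]])
    then have "isCont (deriv f) z" using r(1) by (intro continuous_on_interior) auto
    then show ?thesis unfolding isCont_def using nF_le tendsto_mono by blast
  qed
  have f'z: "deriv f z = 0"
  proof (rule DERIV_local_min[OF f_deriv[OF z(1)] r(1)])
    show "\<forall>y. \<bar>z - y\<bar> < r \<longrightarrow> f z \<le> f y"
    proof (intro allI impI)
      fix y assume "\<bar>z - y\<bar> < r"
      then have "y \<in> {z - r..z + r}" by auto
      then show "f z \<le> f y" using f_nonneg r(2) z(2) by auto
    qed
  qed
  have f_lim: "(f \<longlongrightarrow> 0) nF"
    using DERIV_isCont[OF f_deriv[OF z(1)]] z(2) nF_le tendsto_mono unfolding isCont_def by metis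
  define \<phi> where "\<phi> t = \<bar>t\<bar> powr (p - 2) * t" for t :: real
  have u_lim: "((\<lambda>x. \<phi> (deriv f x)) \<longlongrightarrow> 0) nF"
  proof -
    have "isCont \<phi> (deriv f z)" unfolding \<phi>_def by (rule DERIV_isCont[OF signed_power_has_derivative[OF p]])
    from isCont_tendsto_compose[OF this f'_lim] show ?thesis by (simp add: f'z \<phi>_def)
  qed
  \<comment> \<open>\<open>H\<close> is bounded above near \<open>0\<close>, so a large modulus means a large negative value\<close>
  have H_lim: "filterlim (\<lambda>x. - H (f x)) at_top nF"
    unfolding filterlim_at_top
  proof
    fix M :: real
    define M' where "M' = max \<bar>M\<bar> \<bar>H 1\<bar> + 1"
    have M': "0 < M'" "M \<le> M'" "H 1 < M'" by (auto simp: M'_def)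
    have "\<forall>\<^sub>F x in nF. \<bar>\<phi> (deriv f x)\<bar> < \<eta> / M'"
      using tendstoD[OF u_lim, of "\<eta> / M'"] \<eta> M' by (simp add: dist_real_def)
    moreover have "\<forall>\<^sub>F x in nF. f x < 1" using f_lim by (rule order_tendstoD) simp
    ultimately show "\<forall>\<^sub>F x in nF. M \<le> - H (f x)" using ev0
    proof eventually_elim
      case (elim x)
      have "\<eta> \<le> \<sigma> * (\<phi> (deriv f x) * H (f x))"
        using elim boundary_term_pos[of x] by (simp add: \<phi>_def)
      also have "\<dots> \<le> \<bar>\<phi> (deriv f x)\<bar> * \<bar>H (f x)\<bar>"
        using \<sigma> by (auto simp: abs_mult[symmetric])
      finally have le: "\<eta> \<le> \<bar>\<phi> (deriv f x)\<bar> * \<bar>H (f x)\<bar>" .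
      have "M' < \<bar>H (f x)\<bar>"
      proof (rule ccontr)
        assume "\<not> ?thesis"
        then have "\<bar>\<phi> (deriv f x)\<bar> * \<bar>H (f x)\<bar> \<le> \<bar>\<phi> (deriv f x)\<bar> * M'" by (intro mult_left_mono) auto
        also have "\<dots> < \<eta>" using elim M'(1) by (simp add: field_simps)
        finally show False using le by simp
      qed
      moreover have "H (f x) \<le> H 1" using elim by (intro H_mono) auto
      ultimately show ?case using M' by linarith
    qed
  qed
  have neg_H: "\<forall>\<^sub>F x in nF. 0 < - H (f x)"
    using H_lim unfolding filterlim_at_top_dense by blast
  have "\<forall>\<^sub>F x in nF. \<sigma> * deriv f x < 0"
    using neg_H ev0
  proof eventually_elim
    case (elim x)
    have "0 < \<sigma> * (\<bar>deriv f x\<bar> powr (p - 2) * deriv f x * H (f x))"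
      using elim \<eta> boundary_term_pos[of x] by simp
    then have "0 < (- H (f x) * \<bar>deriv f x\<bar> powr (p - 2)) * (- (\<sigma> * deriv f x))"
      by (simp add: mult_ac)
    moreover have "0 \<le> - H (f x) * \<bar>deriv f x\<bar> powr (p - 2)"
      using elim by (intro mult_nonneg_nonneg) auto
    ultimately show ?case by (smt (verit) mult_nonneg_nonpos)
  qed
  with neg_H ev0 have "\<forall>\<^sub>F x in nF. x \<in> einterval a b \<and> 0 < f x \<and> \<eta> \<le> \<sigma> * boundary_term p H f x
      \<and> 0 < - H (f x) \<and> \<sigma> * deriv f x < 0"
    by eventually_elim blast
  then obtain e where e: "0 < e" "\<And>x. 0 < \<sigma> * (z - x) \<Longrightarrow> \<sigma> * (z - x) < e \<Longrightarrow>
      x \<in> einterval a b \<and> 0 < f x \<and> \<eta> \<le> \<sigma> * boundary_term p H f x \<and> 0 < - H (f x) \<and> \<sigma> * deriv f x < 0"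
    unfolding nF_iff by blast

  \<comment> \<open>\<open>\<nu>\<close> makes the correction in \<open>Q\<close> at most \<open>\<kappa>/4\<close> (relative to \<open>l0^(-2/p)\<close>), \<open>\<mu>\<close> is then fixed by \<open>young_hardy\<close>,
    and \<open>\<delta>\<close> makes the integral of the source contribute at most another \<open>\<kappa>/4\<close>\<close>
  define \<kappa> where "\<kappa> = \<eta> powr (2 / p)"
  have \<kappa>: "0 < \<kappa>" using \<eta> by (simp add: \<kappa>_def)
  define C where "C = 2 * (p - 1) / p"
  have C: "0 < C" using p by (simp add: C_def)
  define E where "E = C * (1 - 2 / p) * (p / 2)"
  have E: "0 \<le> E" using C p by (auto simp: E_def field_simps)
  define \<nu> where "\<nu> = \<kappa> / (4 * (E + 1))"
  have \<nu>: "0 < \<nu>" using \<kappa> E by (simp add: \<nu>_def)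
  have E\<nu>: "E * \<nu> \<le> \<kappa> / 4" using \<kappa> E by (simp add: \<nu>_def field_simps)
  define \<mu> where "\<mu> = \<nu> powr (- (1 - 2 / p) * (p / 2))"
  have \<mu>: "0 < \<mu>" using \<nu> by (simp add: \<mu>_def)
  have \<mu>\<nu>: "\<mu> powr (2 / p) * \<nu> powr (1 - 2 / p) = 1"
    using \<nu> p by (simp add: \<mu>_def powr_powr powr_add[symmetric])
  define D where "D = C * (2 / p) * \<mu>"
  have D: "0 < D" using C p \<mu> by (simp add: D_def)
  define Q where "Q x = \<bar>deriv f x\<bar> powr C - C * (1 - 2 / p) * \<nu> * (p / 2) * (- H (f x)) powr (- 2 / p)" for x
  have Q_lim: "(Q \<longlongrightarrow> 0) nF"
  proof -
    have "((\<lambda>x. \<bar>deriv f x\<bar>) \<longlongrightarrow> 0) nF" using tendsto_rabs[OF f'_lim] f'z by simp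
    then have "((\<lambda>x. \<bar>deriv f x\<bar> powr C) \<longlongrightarrow> 0) nF"
      by (rule tendsto_zero_powrI[OF _ tendsto_const _ C]) simp
    moreover have "((\<lambda>x. (- H (f x)) powr (- 2 / p)) \<longlongrightarrow> 0) nF"
      by (rule tendsto_neg_powr[OF _ H_lim]) (use p in simp)
    ultimately have "(Q \<longlongrightarrow> 0 - C * (1 - 2 / p) * \<nu> * (p / 2) * 0) nF"
      unfolding Q_def by (intro tendsto_diff tendsto_mult tendsto_const)
    then show ?thesis by simp
  qed
  obtain \<delta> where \<delta>: "0 < \<delta>" "\<And>x y. z - r \<le> x \<Longrightarrow> x \<le> y \<Longrightarrow> y \<le> z + r \<Longrightarrow> y - x < \<delta> \<Longrightarrow>
      integral {x..y} source < \<kappa> / (4 * D)"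
    using source_small[of "\<kappa> / (4 * D)" "z - r" "z + r"] \<kappa> D by auto
  define \<rho> where "\<rho> = min (min e r) \<delta> / 2"
  have \<rho>: "0 < \<rho>" "\<rho> < e" "\<rho> < r" "\<rho> < \<delta>" using e(1) r(1) \<delta>(1) by (auto simp: \<rho>_def)
  define t0 where "t0 = z - \<sigma> * \<rho>"
  have t0: "\<sigma> * (z - t0) = \<rho>" using \<sigma> by (auto simp: t0_def)
  define l0 where "l0 = - H (f t0)"
  have good0: "0 < l0" "0 < f t0" "\<eta> \<le> \<sigma> * boundary_term p H f t0" "\<sigma> * deriv f t0 < 0"
    using e(2)[of t0] t0 \<rho> by (auto simp: l0_def)
  have Q_le: "Q t0 \<le> Q x + D * l0 powr (- 2 / p) * (\<kappa> / (4 * D))"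
    if x: "0 < \<sigma> * (z - x)" "\<sigma> * (z - x) < \<rho>" for x
  proof -
    define s t where "s = min t0 x" and "t = max t0 x"
    have st: "s \<le> t" by (simp add: s_def t_def)
    have between: "0 < \<sigma> * (z - y) \<and> \<sigma> * (z - y) \<le> \<rho>" if "y \<in> {s..t}" for y
      using that x t0 \<sigma> by (auto simp: s_def t_def)
    then have goodst: "y \<in> einterval a b \<and> 0 < f y \<and> 0 < - H (f y) \<and> \<sigma> * deriv f y < 0" if "y \<in> {s..t}" for y
      using e(2)[of y] that \<rho>(2) by fastforce
    have l0_le: "l0 \<le> - H (f y)" if y: "y \<in> {s..t}" for y
    proof -
      have "f y \<le> f t0"
      proof (cases "\<sigma> = 1")
        case True
        then have ty: "t0 \<le> y" using between[OF y] t0 by (simp add: t0_def)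
        have sub: "{t0..y} \<subseteq> {s..t}" using y by (auto simp: s_def)
        show ?thesis
        proof (rule DERIV_nonpos_imp_nonincreasing[OF ty])
          fix q assume "t0 \<le> q" "q \<le> y"
          then have "q \<in> {s..t}" using sub by auto
          from goodst[OF this] show "\<exists>l. (f has_real_derivative l) (at q) \<and> l \<le> 0"
            using f_deriv[of q] True by (intro exI[of _ "deriv f q"]) simp
        qed
      next
        case False
        then have s1: "\<sigma> = - 1" using \<sigma> by simp
        then have ty: "y \<le> t0" using between[OF y] t0 by (simp add: t0_def)
        have sub: "{y..t0} \<subseteq> {s..t}" using y by (auto simp: t_def)
        show ?thesis
        proof (rule DERIV_nonneg_imp_nondecreasing[OF ty])
          fix q assume "y \<le> q" "q \<le> t0"
          then have "q \<in> {s..t}" using sub by auto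
          from goodst[OF this] show "\<exists>l. (f has_real_derivative l) (at q) \<and> 0 \<le> l"
            using f_deriv[of q] s1 by (intro exI[of _ "deriv f q"]) simp
        qed
      qed
      moreover have "0 < f y" using goodst[OF y] by simp
      ultimately show ?thesis using H_mono by (simp add: l0_def)
    qed
    have "- (C * (2 / p) * \<mu> * l0 powr (- 2 / p)) * integral {s..t} source \<le> \<sigma> * (Q t - Q s)"
      unfolding Q_def C_def
      by (rule hardy_segment[OF st _ \<sigma> \<mu> \<nu> \<mu>\<nu> _ _ good0(1) l0_le]) (use goodst in auto)
    moreover have "\<sigma> * (Q t - Q s) = Q x - Q t0"
      using x t0 \<sigma> by (auto simp: s_def t_def)
    moreover have "D * l0 powr (- 2 / p) * integral {s..t} source \<le> D * l0 powr (- 2 / p) * (\<kappa> / (4 * D))"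
    proof (rule mult_left_mono)
      have "z - r \<le> s" "t \<le> z + r" "t - s < \<delta>"
        using between[of s] between[of t] st \<rho> \<sigma> by auto
      from \<delta>(2)[OF this(1) st this(2,3)] show "integral {s..t} source \<le> \<kappa> / (4 * D)" by simp
    qed (use D in simp)
    ultimately show ?thesis by (simp add: D_def)
  qed
  have "\<forall>\<^sub>F x in nF. Q t0 - D * l0 powr (- 2 / p) * (\<kappa> / (4 * D)) \<le> Q x"
    unfolding nF_iff using Q_le \<rho>(1) by (intro exI[of _ \<rho>]) (auto simp: algebra_simps)
  from tendsto_lowerbound[OF Q_lim this nF_bot]
  have "Q t0 \<le> l0 powr (- 2 / p) * (\<kappa> / 4)" using D by simp
  moreover have "Q t0 = \<bar>deriv f t0\<bar> powr C - E * \<nu> * l0 powr (- 2 / p)"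
    by (simp only: Q_def E_def l0_def mult_ac)
  ultimately have "\<bar>deriv f t0\<bar> powr C \<le> l0 powr (- 2 / p) * (\<kappa> / 4) + E * \<nu> * l0 powr (- 2 / p)"
    by linarith
  also have "\<dots> \<le> l0 powr (- 2 / p) * (\<kappa> / 4) + \<kappa> / 4 * l0 powr (- 2 / p)"
    using E\<nu> by (intro add_left_mono mult_right_mono) auto
  finally have "\<bar>deriv f t0\<bar> powr C \<le> \<kappa> / 2 * l0 powr (- 2 / p)" by simp
  then have "\<bar>deriv f t0\<bar> powr C * l0 powr (2 / p) \<le> \<kappa> / 2 * l0 powr (- 2 / p) * l0 powr (2 / p)"
    by (intro mult_right_mono) auto
  also have "\<dots> = \<kappa> / 2" using good0(1) by (simp add: powr_add[symmetric] mult.assoc)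
  finally have upper: "\<bar>deriv f t0\<bar> powr C * l0 powr (2 / p) \<le> \<kappa> / 2" .
  define v where "v = \<bar>deriv f t0\<bar>"
  have v: "0 < v" "v = - \<sigma> * deriv f t0" using good0(4) \<sigma> by (auto simp: v_def)
  have "\<sigma> * boundary_term p H f t0 = v powr (p - 2) * v * l0"
    using good0(2) by (simp add: boundary_term_pos l0_def v_def[symmetric]) (simp add: v(2))
  also have "v powr (p - 2) * v = v powr (p - 1)"
    using powr_mult_base[of v "p - 2"] v(1) by (simp add: mult.commute)
  finally have "\<eta> \<le> v powr (p - 1) * l0" using good0(3) by simp
  then have "\<kappa> \<le> (v powr (p - 1) * l0) powr (2 / p)"
    unfolding \<kappa>_def using \<eta> p by (intro powr_mono2) auto
  also have "\<dots> = v powr C * l0 powr (2 / p)"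
    using v(1) good0(1) by (simp add: powr_mult powr_powr C_def mult.commute)
  finally show False using upper \<kappa> by (simp add: v_def)
qed

end

section \<open>Gluing across zeros\<close>

context half_line_weight
begin

lemma f_cont: "continuous_on (einterval a b) f"
  by (rule DERIV_continuous_on) (auto intro: has_field_derivative_at_within f_deriv)

text \<open>The energy with a continuous cut-off: it vanishes for \<open>f \<le> 1/(n+1)\<close> and is the full energy for
  \<open>f \<ge> 2/(n+1)\<close>. The maximum keeps the argument of \<open>h\<close> in \<open>(0,\<infinity>)\<close>, so that the function is continuous
  on all of \<open>(a,b)\<close>, zeros of \<open>f\<close> included.\<close>

definition cut_energy :: "nat \<Rightarrow> real \<Rightarrow> real" where
  "cut_energy n x = \<bar>deriv f x\<bar> powr p * h (max (f x) (1 / real (Suc n))) *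
     max 0 (min 1 (real (Suc n) * f x - 1))"

lemma cut_energy_nonneg: "0 \<le> cut_energy n x"
  unfolding cut_energy_def
  by (intro mult_nonneg_nonneg less_imp_le[OF h_pos]) (auto simp: less_max_iff_disj)

lemma cut_energy_eq_0:
  assumes "f x < 1 / real (Suc n)"
  shows "cut_energy n x = 0"
proof -
  have "real (Suc n) * f x \<le> 1" using assms by (simp add: field_simps)
  then show ?thesis by (simp add: cut_energy_def)
qed

lemma cut_energy_le: "0 < f x \<Longrightarrow> cut_energy n x \<le> energy x"
proof (cases "f x < 1 / real (Suc n)")
  case True
  assume "0 < f x"
  then show ?thesis using h_pos[of "f x"] True by (simp add: cut_energy_eq_0 energy_def)
next
  case False
  assume "0 < f x"
  then have "0 \<le> energy x" using h_pos[of "f x"] by (simp add: energy_def)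
  moreover have "cut_energy n x = energy x * max 0 (min 1 (real (Suc n) * f x - 1))"
    using False by (simp add: cut_energy_def energy_def max_absorb1)
  ultimately show ?thesis
    using mult_left_mono[of "max 0 (min 1 (real (Suc n) * f x - 1))" 1 "energy x"] by simp
qed

lemma cut_energy_tendsto:
  assumes "0 < f x"
  shows "(\<lambda>n. cut_energy n x) \<longlonglongrightarrow> energy x"
proof (rule tendsto_eventually)
  have "\<forall>\<^sub>F n in sequentially. 2 / f x \<le> real n"
    using eventually_ge_at_top[of "nat \<lceil>2 / f x\<rceil>"] by eventually_elim linarith
  then show "\<forall>\<^sub>F n in sequentially. cut_energy n x = energy x"
  proof eventually_elim
    case (elim n)
    then have 2: "2 \<le> real (Suc n) * f x" using assms by (simp add: field_simps)
    then have "1 / real (Suc n) \<le> f x" by (simp add: field_simps)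
    with 2 show ?case by (simp add: cut_energy_def energy_def max_absorb1 min_absorb1)
  qed
qed

lemma cut_energy_cont:
  assumes sub: "{y..z} \<subseteq> einterval a b"
  shows "continuous_on {y..z} (cut_energy n)"
proof -
  have f: "continuous_on {y..z} f" by (rule continuous_on_subset[OF f_cont sub])
  have f': "continuous_on {y..z} (deriv f)"
    by (rule abs_continuous_on_imp_continuous_on[OF f'_AC_on[OF sub]])
  have "continuous_on {y..z} (\<lambda>x. h (max (f x) (1 / real (Suc n))))"
    by (rule continuous_on_compose2[OF h_cont]) (auto intro!: continuous_intros f simp: less_max_iff_disj)
  moreover have "continuous_on {y..z} (\<lambda>x. \<bar>deriv f x\<bar> powr p)"
    by (rule continuous_on_powr') (use p in \<open>auto intro!: continuous_intros f'\<close>)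
  moreover have "continuous_on {y..z} (\<lambda>x. max 0 (min 1 (real (Suc n) * f x - 1)))"
    by (intro continuous_intros f)
  ultimately show ?thesis
    unfolding cut_energy_def by (intro continuous_on_mult)
qed

lemma cut_energy_integrable: "{y..z} \<subseteq> einterval a b \<Longrightarrow> cut_energy n integrable_on {y..z}"
  using cut_energy_cont by (rule integrable_continuous_interval)

text \<open>Measurability of \<open>f''\<close> comes from its local integrability on compact subintervals.\<close>

lemma source_measurable: "source \<in> borel_measurable lebesgue"
proof (cases "a < b")
  case False
  then have "einterval a b = {}" by (auto simp: einterval_iff)
  then have "source = (\<lambda>x. 0)" by (auto simp: source_def)
  then show ?thesis by simp
next
  case True
  obtain u l :: "nat \<Rightarrow> real" where ul: "einterval a b = (\<Union>i. {l i .. u i})" "incseq u" "decseq l"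
    "\<And>i. l i < u i"
    by (rule einterval_Icc_approximation[OF True]) blast
  define hm where "hm s = indicator {0<..} s *\<^sub>R h s" for s
  define Tm where "Tm s = indicator {0<..} s *\<^sub>R T_transform H h s" for s
  have hm[measurable]: "hm \<in> borel_measurable borel"
    unfolding hm_def by (rule borel_measurable_continuous_on_indicator[OF _ h_cont]) simp
  have "continuous_on {0<..} (T_transform H h)"
    unfolding T_transform_def by (intro continuous_intros H_cont h_cont) (use h_pos in force)
  then have Tm[measurable]: "Tm \<in> borel_measurable borel"
    unfolding Tm_def by (intro borel_measurable_continuous_on_indicator) simp_all
  define fi where "fi i x = f (max (l i) (min (u i) x))" for i x
  define gi where "gi i x = indicator {l i..u i} x *\<^sub>R deriv (deriv f) x" for i x
  define si where "si i x = indicator {l i..u i} x * (\<bar>gi i x * Tm (fi i x)\<bar> powr (p / 2) * hm (fi i x))" for i x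
  have "si i \<in> borel_measurable lebesgue" for i
  proof -
    have sub: "{l i..u i} \<subseteq> einterval a b" using ul(1) by blast
    have "continuous_on UNIV (fi i)" unfolding fi_def
      by (rule continuous_on_compose2[OF continuous_on_subset[OF f_cont sub]])
        (use ul(4)[of i] in \<open>auto intro!: continuous_intros\<close>)
    then have "fi i \<in> borel_measurable borel" by (rule borel_measurable_continuous_onI)
    then have [measurable]: "fi i \<in> borel_measurable lebesgue" by (simp add: measurable_completion)
    have "deriv (deriv f) absolutely_integrable_on {l i..u i}"
      using abs_continuous_FTC[OF less_imp_le[OF ul(4)] f'_AC_on[OF sub]] by blast
    then have [measurable]: "gi i \<in> borel_measurable lebesgue"
      unfolding gi_def set_integrable_def by (rule borel_measurable_integrable)
    have [measurable]: "(indicator {l i..u i} :: real \<Rightarrow> real) \<in> borel_measurable lebesgue"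
      by (intro borel_measurable_indicator) simp
    have [measurable]: "(\<lambda>x. Tm (fi i x)) \<in> borel_measurable lebesgue"
      "(\<lambda>x. hm (fi i x)) \<in> borel_measurable lebesgue"
      by (rule measurable_compose[of "fi i" lebesgue borel]; simp)+
    show ?thesis unfolding si_def by measurable
  qed
  then show ?thesis
  proof (rule borel_measurable_LIMSEQ_real[rotated])
    fix x :: real
    show "(\<lambda>i. si i x) \<longlonglongrightarrow> source x"
    proof (cases "x \<in> einterval a b")
      case False
      then have "si i x = source x" for i using ul(1) by (auto simp: si_def source_def)
      then show ?thesis by simp
    next
      case True
      then obtain i where i: "x \<in> {l i..u i}" using ul(1) by blast
      have "\<forall>\<^sub>F j in sequentially. si j x = source x"
        using eventually_ge_at_top[of i]
      proof eventually_elim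
        case (elim j)
        then have "l j \<le> l i" "u i \<le> u j" using ul(2,3) by (auto simp: incseq_def decseq_def)
        then have j: "x \<in> {l j..u j}" using i by auto
        then have "fi j x = f x" by (simp add: fi_def)
        with j True f_nonneg[OF True] show ?case
          by (simp add: si_def source_def gi_def Tm_def hm_def indicator_def)
      qed
      then show ?thesis by (rule tendsto_eventually)
    qed
  qed
qed

end

context half_line_weight_finite
begin

lemma source_integral_nonneg: "0 \<le> integral {y..z} source"
  by (rule integral_nonneg[OF source_integrable_on source_nonneg])

lemma source_integral_combine:
  "y \<le> x \<Longrightarrow> x \<le> z \<Longrightarrow> integral {y..x} source + integral {x..z} source = integral {y..z} source"
  by (rule Henstock_Kurzweil_Integration.integral_combine[OF _ _ source_integrable_on])

lemma boundary_term_increment_ge: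
  assumes yz: "y \<le> z" and sub: "{y..z} \<subseteq> einterval a b" and pos: "\<And>x. x \<in> {y..z} \<Longrightarrow> 0 < f x"
  shows "- (2 / p * K * integral {y..z} source) \<le> boundary_term p H f z - boundary_term p H f y"
proof -
  have "2 / p * integral {y..z} (\<lambda>x. - K * source x) \<le> boundary_term p H f z - boundary_term p H f y"
  proof (rule increment_on_positive_interval[OF yz sub pos])
    show "(\<lambda>x. - K * source x) integrable_on {y..z}"
      by (rule integrable_on_mult_right[OF source_integrable_on])
    show "- K * source x \<le> energy x - K * source x" if "x \<in> {y..z}" for x
      using pos[OF that] h_pos[of "f x"] by (simp add: energy_def)
  qed
  then show ?thesis by (simp add: mult_ac)
qed

lemma boundary_term_le_left_of_zero:
  assumes yx: "y \<le> x" and sub: "{y..x} \<subseteq> einterval a b" and fx: "f x = 0"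
  shows "boundary_term p H f y \<le> 2 / p * K * integral {y..x} source"
proof (cases "f y = 0")
  case True
  then show ?thesis using p K_pos source_integral_nonneg[of y x] by (simp add: boundary_term_zero)
next
  case False
  define S where "S = {t \<in> {y..x}. f t = 0}"
  have cf: "continuous_on {y..x} f" by (rule continuous_on_subset[OF f_cont sub])
  have "closed S" unfolding S_def by (rule continuous_closed_preimage_constant[OF cf]) simp
  moreover have S: "S \<noteq> {}" "bdd_below S" using yx fx by (auto simp: S_def)
  ultimately have zS: "Inf S \<in> S" by (intro closed_contains_Inf)
  \<comment> \<open>the first zero after \<open>y\<close>\<close>
  define z where "z = Inf S"
  have z: "y \<le> z" "z \<le> x" "f z = 0" using zS by (auto simp: S_def z_def)
  have yz: "y < z" using z False by (cases "y = z") auto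
  have pos: "0 < f t" if "y \<le> t" "t < z" for t
  proof -
    have "t \<notin> S" using that(2) cInf_lower[OF _ S(2), of t] by (auto simp: z_def)
    then have "f t \<noteq> 0" using that z by (simp add: S_def)
    moreover have "0 \<le> f t" by (rule f_nonneg, rule subsetD[OF sub]) (use that z in auto)
    ultimately show ?thesis by simp
  qed
  show ?thesis
  proof (rule field_le_epsilon)
    fix \<eta> :: real assume \<eta>: "0 < \<eta>"
    have "\<exists>t. 0 < 1 * (z - t) \<and> 1 * (z - t) < z - y \<and> 1 * boundary_term p H f t < \<eta>"
      by (rule boundary_term_small_near_zero[OF _ z(3) _ \<eta>]) (use z yz sub pos in auto)
    then obtain t where t: "y < t" "t < z" "boundary_term p H f t < \<eta>" by auto
    have "- (2 / p * K * integral {y..t} source) \<le> boundary_term p H f t - boundary_term p H f y"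
      by (rule boundary_term_increment_ge) (use t z sub pos in auto)
    moreover have "2 / p * K * integral {y..t} source \<le> 2 / p * K * integral {y..x} source"
      using source_integral_combine[of y t x] source_integral_nonneg[of t x] t z p K_pos
      by (intro mult_left_mono) auto
    ultimately show "boundary_term p H f y \<le> 2 / p * K * integral {y..x} source + \<eta>"
      using t(3) by linarith
  qed
qed

lemma boundary_term_ge_right_of_zero:
  assumes xy: "x \<le> y" and sub: "{x..y} \<subseteq> einterval a b" and fx: "f x = 0"
  shows "- (2 / p * K * integral {x..y} source) \<le> boundary_term p H f y"
proof (cases "f y = 0")
  case True
  then show ?thesis using p K_pos source_integral_nonneg[of x y] by (simp add: boundary_term_zero)
next
  case False
  define S where "S = {t \<in> {x..y}. f t = 0}"
  have cf: "continuous_on {x..y} f" by (rule continuous_on_subset[OF f_cont sub])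
  have "closed S" unfolding S_def by (rule continuous_closed_preimage_constant[OF cf]) simp
  moreover have S: "S \<noteq> {}" "bdd_above S" using xy fx by (auto simp: S_def)
  ultimately have zS: "Sup S \<in> S" by (intro closed_contains_Sup)
  \<comment> \<open>the last zero before \<open>y\<close>\<close>
  define z where "z = Sup S"
  have z: "x \<le> z" "z \<le> y" "f z = 0" using zS by (auto simp: S_def z_def)
  have zy: "z < y" using z False by (cases "y = z") auto
  have pos: "0 < f t" if "z < t" "t \<le> y" for t
  proof -
    have "t \<notin> S" using that(1) cSup_upper[OF _ S(2), of t] by (auto simp: z_def)
    then have "f t \<noteq> 0" using that z by (simp add: S_def)
    moreover have "0 \<le> f t" by (rule f_nonneg, rule subsetD[OF sub]) (use that z in auto)
    ultimately show ?thesis by simp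
  qed
  have "- boundary_term p H f y \<le> 2 / p * K * integral {x..y} source"
  proof (rule field_le_epsilon)
    fix \<eta> :: real assume \<eta>: "0 < \<eta>"
    have "\<exists>t. 0 < - 1 * (z - t) \<and> - 1 * (z - t) < y - z \<and> - 1 * boundary_term p H f t < \<eta>"
      by (rule boundary_term_small_near_zero[OF _ z(3) _ \<eta>]) (use z zy sub pos in auto)
    then obtain t where t: "z < t" "t < y" "- boundary_term p H f t < \<eta>" by auto
    have "- (2 / p * K * integral {t..y} source) \<le> boundary_term p H f y - boundary_term p H f t"
      by (rule boundary_term_increment_ge) (use t z sub pos in auto)
    moreover have "2 / p * K * integral {t..y} source \<le> 2 / p * K * integral {x..y} source"
      using source_integral_combine[of x t y] source_integral_nonneg[of x t] t z p K_pos
      by (intro mult_left_mono) auto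
    ultimately show "- boundary_term p H f y \<le> 2 / p * K * integral {x..y} source + \<eta>"
      using t(3) by linarith
  qed
  then show ?thesis by simp
qed

text \<open>The basic inequality on an arbitrary compact subinterval. By bisection only short intervals around a
  point \<open>x\<close> matter. If \<open>f x > 0\<close> then \<open>f\<close> is positive on them; if \<open>f x = 0\<close> then the cut-off energy vanishes on
  them, and the two one-sided estimates at the zero \<open>x\<close> apply.\<close>

lemma cut_energy_increment:
  assumes rR: "r \<le> R" and sub: "{r..R} \<subseteq> einterval a b"
  shows "2 / p * (integral {r..R} (cut_energy n) - K * integral {r..R} source)
    \<le> boundary_term p H f R - boundary_term p H f r"
proof -
  define P where "P y z \<longleftrightarrow> (r \<le> y \<longrightarrow> z \<le> R \<longrightarrow>
    2 / p * (integral {y..z} (cut_energy n) - K * integral {y..z} source)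
      \<le> boundary_term p H f z - boundary_term p H f y)" for y z
  have sub': "{y..z} \<subseteq> einterval a b" if "r \<le> y" "z \<le> R" for y z using that sub by auto
  have "P r R" using rR
  proof (induction rule: Bolzano)
    case (trans x y z)
    show ?case unfolding P_def
    proof (intro impI)
      assume rz: "r \<le> x" "z \<le> R"
      have "integral {x..y} (cut_energy n) + integral {y..z} (cut_energy n) = integral {x..z} (cut_energy n)"
        by (rule Henstock_Kurzweil_Integration.integral_combine[OF trans(3,4) cut_energy_integrable[OF sub'[OF rz]]])
      moreover note source_integral_combine[OF trans(3,4)]
      ultimately have "2 / p * (integral {x..z} (cut_energy n) - K * integral {x..z} source)
          = 2 / p * (integral {x..y} (cut_energy n) - K * integral {x..y} source)
            + 2 / p * (integral {y..z} (cut_energy n) - K * integral {y..z} source)"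
        by (metis (no_types, opaque_lifting) add_diff_add distrib_left)
      then show "2 / p * (integral {x..z} (cut_energy n) - K * integral {x..z} source)
          \<le> boundary_term p H f z - boundary_term p H f x"
        using trans rz unfolding P_def by linarith
    qed
  next
    case (local x)
    have xab: "x \<in> einterval a b" using local sub by auto
    have "isCont f x" by (rule DERIV_isCont[OF f_deriv[OF xab]])
    then have flim: "(f \<longlongrightarrow> f x) (nhds x)" by (simp add: continuous_within tendsto_at_iff_tendsto_nhds)
    show ?case
    proof (cases "f x = 0")
      case False
      then have "0 < f x" using f_nonneg[OF xab] by simp
      from order_tendstoD(1)[OF flim this] obtain \<delta> where \<delta>: "0 < \<delta>" "\<And>t. dist t x < \<delta> \<Longrightarrow> 0 < f t"
        unfolding eventually_nhds_metric by blast
      show ?thesis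
      proof (intro exI[of _ \<delta>] conjI allI impI \<delta>(1))
        fix y z assume yz: "y \<le> x \<and> x \<le> z \<and> z - y < \<delta>"
        then have pos: "0 < f t" if "t \<in> {y..z}" for t
          using that by (intro \<delta>(2)) (auto simp: dist_real_def abs_if)
        show "P y z" unfolding P_def
        proof (intro impI)
          assume rz: "r \<le> y" "z \<le> R"
          note int = cut_energy_integrable[OF sub'[OF rz]] integrable_on_mult_right[OF source_integrable_on, of K]
          have "2 / p * integral {y..z} (\<lambda>x. cut_energy n x - K * source x)
              \<le> boundary_term p H f z - boundary_term p H f y"
            by (rule increment_on_positive_interval[OF _ sub'[OF rz] pos integrable_diff[OF int]])
              (use yz pos cut_energy_le in auto)
          also have "integral {y..z} (\<lambda>x. cut_energy n x - K * source x)
              = integral {y..z} (cut_energy n) - K * integral {y..z} source"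
            using integral_diff[OF int] by simp
          finally show "2 / p * (integral {y..z} (cut_energy n) - K * integral {y..z} source)
              \<le> boundary_term p H f z - boundary_term p H f y" .
        qed
      qed
    next
      case True
      then have "f x < 1 / real (Suc n)" by simp
      from order_tendstoD(2)[OF flim this]
      obtain \<delta> where \<delta>: "0 < \<delta>" "\<And>t. dist t x < \<delta> \<Longrightarrow> f t < 1 / real (Suc n)"
        unfolding eventually_nhds_metric by blast
      show ?thesis
      proof (intro exI[of _ \<delta>] conjI allI impI \<delta>(1))
        fix y z assume yz: "y \<le> x \<and> x \<le> z \<and> z - y < \<delta>"
        then have small: "f t < 1 / real (Suc n)" if "t \<in> {y..z}" for t
          using that by (intro \<delta>(2)) (auto simp: dist_real_def abs_if)
        show "P y z" unfolding P_def
        proof (intro impI)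
          assume rz: "r \<le> y" "z \<le> R"
          have "integral {y..z} (cut_energy n) = integral {y..z} (\<lambda>x. 0)"
            by (rule integral_cong) (use small cut_energy_eq_0 in blast)
          then have "2 / p * (integral {y..z} (cut_energy n) - K * integral {y..z} source)
              = - (2 / p * K * integral {y..x} source) - 2 / p * K * integral {x..z} source"
            using source_integral_combine[of y x z, symmetric] yz by (simp add: algebra_simps)
          also have "\<dots> \<le> boundary_term p H f z - boundary_term p H f y"
            using boundary_term_le_left_of_zero[of y x] boundary_term_ge_right_of_zero[of x z]
              sub'[of y x] sub'[of x z] yz rz True by auto
          finally show "2 / p * (integral {y..z} (cut_energy n) - K * integral {y..z} source)
              \<le> boundary_term p H f z - boundary_term p H f y" .
        qed
      qed
    qed
  qed
  then show ?thesis unfolding P_def by simp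
qed

end

section \<open>Passage to the end points\<close>

lemma frequently_below_Liminf_at_left:
  fixes g :: "real \<Rightarrow> real" and b :: ereal
  assumes "Liminf (at_left b) (\<lambda>R. ereal (g (real_of_ereal R))) < ereal m" and "ereal R0 < b"
  shows "\<exists>R. R0 < R \<and> ereal R < b \<and> g R < m"
proof (rule ccontr)
  assume not: "\<not> ?thesis"
  have "\<forall>\<^sub>F R in at_left b. ereal m \<le> ereal (g (real_of_ereal R))"
    unfolding eventually_at_left[OF assms(2)]
  proof (intro exI[of _ "ereal R0"] conjI assms(2) allI impI)
    fix R assume R: "ereal R0 < R" "R < b"
    then obtain x where x: "R = ereal x" by (cases R) auto
    then have "\<not> g x < m" using not R by auto
    then show "ereal m \<le> ereal (g (real_of_ereal R))" using x by simp
  qed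
  then have "ereal m \<le> Liminf (at_left b) (\<lambda>R. ereal (g (real_of_ereal R)))"
    by (rule Liminf_bounded)
  with assms(1) show False by simp
qed

lemma frequently_above_Limsup_at_right:
  fixes g :: "real \<Rightarrow> real" and a :: ereal
  assumes "ereal m < Limsup (at_right a) (\<lambda>r. ereal (g (real_of_ereal r)))" and "a < ereal r0"
  shows "\<exists>r. r < r0 \<and> a < ereal r \<and> m < g r"
proof (rule ccontr)
  assume not: "\<not> ?thesis"
  have "\<forall>\<^sub>F r in at_right a. ereal (g (real_of_ereal r)) \<le> ereal m"
    unfolding eventually_at_right[OF assms(2)]
  proof (intro exI[of _ "ereal r0"] conjI assms(2) allI impI)
    fix r assume r: "a < r" "r < ereal r0"
    then obtain x where x: "r = ereal x" by (cases r) auto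
    then have "\<not> m < g x" using not r by auto
    then show "ereal (g (real_of_ereal r)) \<le> ereal m" using x by simp
  qed
  then have "Limsup (at_right a) (\<lambda>r. ereal (g (real_of_ereal r))) \<le> ereal m"
    by (rule Limsup_bounded)
  with assms(1) show False by simp
qed

text \<open>The conventions \<open>\<infinity> - \<infinity> = \<infinity>\<close> and \<open>(-\<infinity>) - (-\<infinity>) = \<infinity>\<close> enter here: the separating number is real.\<close>

lemma ereal_diff_nonpos_separated:
  fixes A B :: ereal
  assumes "A - B \<le> 0"
  shows "\<exists>m::real. A \<le> ereal m \<and> ereal m \<le> B"
proof (cases A)
  case (real x)
  with assms show ?thesis by (cases B) (auto intro!: exI[of _ x])
next
  case PInf
  with assms show ?thesis by simp
next
  case MInf
  with assms show ?thesis by (cases B) auto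
qed

context half_line_weight_finite
begin

text \<open>Passage to the end points. The boundary condition provides a real number \<open>m\<close> between the lower limit of
  the boundary term at \<open>b\<close> and its upper limit at \<open>a\<close>. Hence the boundary term is below \<open>m + \<eta>\<close> at points
  arbitrarily close to \<open>b\<close>, and above \<open>m - \<eta>\<close> at points arbitrarily close to \<open>a\<close>. Fatou's lemma removes the
  cut-off.\<close>

lemma energy_nn_integral_le:
  assumes ab: "a < b"
    and bc: "Liminf (at_left b) (\<lambda>R. ereal (boundary_term p H f (real_of_ereal R)))
       - Limsup (at_right a) (\<lambda>r. ereal (boundary_term p H f (real_of_ereal r))) \<le> 0"
  shows "(\<integral>\<^sup>+ x \<in> {x \<in> einterval a b. 0 < f x}. ennreal (energy x) \<partial>lebesgue)
    \<le> ennreal (K * integral UNIV source)"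
proof -
  define I where "I = integral UNIV source"
  obtain m where m: "Liminf (at_left b) (\<lambda>R. ereal (boundary_term p H f (real_of_ereal R))) \<le> ereal m"
    "ereal m \<le> Limsup (at_right a) (\<lambda>r. ereal (boundary_term p H f (real_of_ereal r)))"
    using ereal_diff_nonpos_separated[OF bc] by blast
  have cut_le: "integral {r0..R0} (cut_energy n) \<le> K * I"
    if rR: "r0 < R0" "{r0..R0} \<subseteq> einterval a b" for r0 R0 n
  proof (rule field_le_epsilon)
    fix e :: real assume "0 < e"
    \<comment> \<open>the boundary terms contribute \<open>2 \<eta>\<close>, which is multiplied by \<open>p/2\<close>\<close>
    define \<eta> where "\<eta> = e / p"
    have \<eta>: "0 < \<eta>" using \<open>0 < e\<close> p by (simp add: \<eta>_def)
    have in0: "a < ereal r0" "ereal R0 < b"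
      using rR by (auto simp: subset_iff einterval_iff)
    have "Liminf (at_left b) (\<lambda>R. ereal (boundary_term p H f (real_of_ereal R))) < ereal (m + \<eta>)"
      by (rule le_less_trans[OF m(1)]) (use \<eta> in simp)
    from frequently_below_Liminf_at_left[OF this in0(2)]
    obtain R where R: "R0 < R" "ereal R < b" "boundary_term p H f R < m + \<eta>" by blast
    have "ereal (m - \<eta>) < Limsup (at_right a) (\<lambda>r. ereal (boundary_term p H f (real_of_ereal r)))"
      by (rule less_le_trans[OF _ m(2)]) (use \<eta> in simp)
    from frequently_above_Limsup_at_right[OF this in0(1)]
    obtain r where r: "r < r0" "a < ereal r" "m - \<eta> < boundary_term p H f r" by blast
    have sub: "{r..R} \<subseteq> einterval a b"
    proof
      fix x assume "x \<in> {r..R}"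
      then have "ereal r \<le> ereal x" "ereal x \<le> ereal R" by auto
      then show "x \<in> einterval a b"
        unfolding einterval_iff using less_le_trans[OF r(2)] le_less_trans[OF _ R(2)] by blast
    qed
    have "integral {r0..R0} (cut_energy n) \<le> integral {r..R} (cut_energy n)"
      by (rule integral_subset_le)
        (use r R rR sub cut_energy_integrable cut_energy_nonneg in auto)
    moreover have "2 / p * (integral {r..R} (cut_energy n) - K * integral {r..R} source)
        \<le> boundary_term p H f R - boundary_term p H f r"
      by (rule cut_energy_increment[OF _ sub]) (use r R rR in simp)
    then have "2 / p * (integral {r..R} (cut_energy n) - K * integral {r..R} source) \<le> 2 / p * e"
      using R(3) r(3) p by (simp add: \<eta>_def)
    then have "integral {r..R} (cut_energy n) - K * integral {r..R} source \<le> e"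
      using p by (subst (asm) mult_le_cancel_left_pos) simp_all
    moreover have "K * integral {r..R} source \<le> K * I" unfolding I_def
    proof (rule mult_left_mono)
      show "integral {r..R} source \<le> integral UNIV source"
        by (rule integral_subset_le)
          (use source_integrable_on source_integrable source_nonneg in auto)
    qed (use K_pos in simp)
    ultimately show "integral {r0..R0} (cut_energy n) \<le> K * I + e" by linarith
  qed
  obtain u l :: "nat \<Rightarrow> real" where ul: "einterval a b = (\<Union>i. {l i .. u i})" "incseq u" "decseq l"
    "\<And>i. l i < u i"
    by (rule einterval_Icc_approximation[OF ab]) blast
  have sub: "{l i..u i} \<subseteq> einterval a b" for i using ul(1) by blast
  define c where "c n x = indicator {l n..u n} x *\<^sub>R cut_energy n x" for n x
  have c_meas: "(\<lambda>x. ennreal (c n x)) \<in> borel_measurable lebesgue" for n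
  proof -
    have "c n \<in> borel_measurable borel"
      unfolding c_def by (rule borel_measurable_continuous_on_indicator[OF _ cut_energy_cont[OF sub]]) simp
    then have "c n \<in> borel_measurable lebesgue" by (simp add: measurable_completion)
    then show ?thesis by measurable
  qed
  have c_le: "(\<integral>\<^sup>+ x. ennreal (c n x) \<partial>lebesgue) \<le> ennreal (K * I)" for n
  proof -
    have "(\<integral>\<^sup>+ x. ennreal (c n x) \<partial>lebesgue) = ennreal (integral {l n..u n} (cut_energy n))"
      using nn_integral_has_integral_lebesgue[OF cut_energy_nonneg
          integrable_integral[OF cut_energy_integrable[OF sub, of n n]]] by (simp add: c_def nn_integral_completion)
    also have "\<dots> \<le> ennreal (K * I)" by (rule ennreal_leI[OF cut_le[OF ul(4) sub]])
    finally show ?thesis .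
  qed
  have "(\<integral>\<^sup>+ x \<in> {x \<in> einterval a b. 0 < f x}. ennreal (energy x) \<partial>lebesgue)
      \<le> (\<integral>\<^sup>+ x. liminf (\<lambda>n. ennreal (c n x)) \<partial>lebesgue)"
  proof (rule nn_integral_mono)
    fix x
    show "ennreal (energy x) * indicator {x \<in> einterval a b. 0 < f x} x \<le> liminf (\<lambda>n. ennreal (c n x))"
    proof (cases "x \<in> einterval a b \<and> 0 < f x")
      case False
      then show ?thesis by (auto simp: indicator_def)
    next
      case True
      then obtain i where i: "x \<in> {l i..u i}" using ul(1) by blast
      have ev: "\<forall>\<^sub>F n in sequentially. cut_energy n x = c n x"
        using eventually_ge_at_top[of i]
      proof eventually_elim
        case (elim n)
        then have "l n \<le> l i" "u i \<le> u n" using ul(2,3) by (auto simp: incseq_def decseq_def)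
        then show ?case using i by (simp add: c_def)
      qed
      have "(\<lambda>n. cut_energy n x) \<longlonglongrightarrow> energy x" using True cut_energy_tendsto[of x] by blast
      from Lim_transform_eventually[OF this ev] have "(\<lambda>n. c n x) \<longlonglongrightarrow> energy x" .
      then have "(\<lambda>n. ennreal (c n x)) \<longlonglongrightarrow> ennreal (energy x)" by (rule tendsto_ennrealI)
      then have "liminf (\<lambda>n. ennreal (c n x)) = ennreal (energy x)"
        by (rule lim_imp_Liminf[OF sequentially_bot])
      then show ?thesis using True by simp
    qed
  qed
  also have "\<dots> \<le> liminf (\<lambda>n. \<integral>\<^sup>+ x. ennreal (c n x) \<partial>lebesgue)"
    by (rule nn_integral_liminf[OF c_meas])
  also have "\<dots> \<le> ennreal (K * I)"
  proof (rule Liminf_le[OF sequentially_bot])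
    show "\<forall>\<^sub>F n in sequentially. (\<integral>\<^sup>+ x. ennreal (c n x) \<partial>lebesgue) \<le> ennreal (K * I)"
      by (intro always_eventually allI c_le)
  qed
  finally show ?thesis by (simp add: I_def)
qed

end

theorem proposition4p3:
  fixes p :: real and a b :: ereal and h H :: "real \<Rightarrow> real"
  assumes "2 \<le> p"
    and "a < b"
    and "continuous_on {0<..} h"
    and "\<forall>s>0. 0 < h s"
    and "loc_AC_primitive H h"
    and "bounded_or_nonincreasing_near_0 h"
    and "bounded_or_nonincreasing_near_0 (\<lambda>s. \<bar>T_transform H h s\<bar> powr (p / 2) * h s)"
  shows "\<forall>f \<in> R_nonneg p H a b. (\<forall>x \<in> einterval a b. 0 \<le> f x) \<longrightarrow>
    (\<integral>\<^sup>+ x \<in> {x \<in> einterval a b. 0 < f x}.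
        ennreal (\<bar>deriv f x\<bar> powr p * h (f x)) \<partial>lebesgue)
    \<le> ennreal (sqrt (p - 1) powr p) *
      (\<integral>\<^sup>+ x \<in> {x \<in> einterval a b. 0 < f x}.
        ennreal (\<bar>deriv (deriv f) x * T_transform H h (f x)\<bar> powr (p / 2) * h (f x)) \<partial>lebesgue)"
proof (intro ballI impI)
  fix f assume f: "f \<in> R_nonneg p H a b" and f0: "\<forall>x \<in> einterval a b. 0 \<le> f x"
  interpret half_line_weight p a b h H f
  proof
    show "(H has_real_derivative h s) (at s)" if "0 < s" for s
      by (rule primitive_of_continuous[OF assms(5,3) that])
  qed (use assms f f0 in \<open>auto simp: R_nonneg_def W21_loc_def\<close>)
  have const: "sqrt (p - 1) powr p = K"
    using p by (simp add: K_def powr_half_sqrt[symmetric] powr_powr)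
  have src: "(\<integral>\<^sup>+ x \<in> {x \<in> einterval a b. 0 < f x}.
        ennreal (\<bar>deriv (deriv f) x * T_transform H h (f x)\<bar> powr (p / 2) * h (f x)) \<partial>lebesgue)
      = (\<integral>\<^sup>+ x. ennreal (source x) \<partial>lebesgue)"
    by (rule nn_integral_cong) (auto simp: source_def indicator_def)
  have "(\<integral>\<^sup>+ x \<in> {x \<in> einterval a b. 0 < f x}. ennreal (energy x) \<partial>lebesgue)
      \<le> ennreal K * (\<integral>\<^sup>+ x. ennreal (source x) \<partial>lebesgue)"
  proof (cases "(\<integral>\<^sup>+ x. ennreal (source x) \<partial>lebesgue) = \<infinity>")
    case True
    then show ?thesis using K_pos by (simp add: ennreal_mult_top)
  next
    case False
    have int: "integrable lebesgue source"
      by (rule integrableI_nonneg[OF source_measurable])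
        (use False source_nonneg in \<open>auto simp: less_top\<close>)
    then have "(\<integral>\<^sup>+ x. ennreal (source x) \<partial>lebesgue) = ennreal (integral\<^sup>L lebesgue source)"
      using source_nonneg by (intro nn_integral_eq_integral) auto
    moreover have "source integrable_on UNIV" "integral\<^sup>L lebesgue source = integral UNIV source"
      using has_integral_integral_lebesgue[OF int] by (auto simp: has_integral_iff)
    moreover interpret half_line_weight_finite p a b h H f
      by unfold_locales fact
    have "(\<integral>\<^sup>+ x \<in> {x \<in> einterval a b. 0 < f x}. ennreal (energy x) \<partial>lebesgue)
        \<le> ennreal (K * integral UNIV source)"
      by (rule energy_nn_integral_le[OF assms(2)]) (use f in \<open>simp add: R_nonneg_def\<close>)
    ultimately show ?thesis using K_pos by (simp add: ennreal_mult')
  qed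
  then show "(\<integral>\<^sup>+ x \<in> {x \<in> einterval a b. 0 < f x}.
        ennreal (\<bar>deriv f x\<bar> powr p * h (f x)) \<partial>lebesgue)
    \<le> ennreal (sqrt (p - 1) powr p) *
      (\<integral>\<^sup>+ x \<in> {x \<in> einterval a b. 0 < f x}.
        ennreal (\<bar>deriv (deriv f) x * T_transform H h (f x)\<bar> powr (p / 2) * h (f x)) \<partial>lebesgue)"
    unfolding src const energy_def .
qed

end
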